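(* Let $n,r\ge 1$ and let $\sigma$ be a partition of $r$. The eigenvalue map $\omega_\sigma$, sending the class of $(A,B)\in X_\sigma^*$ to the collection of eigenvalues of $A$, is a Zariski locally trivial fiber bundle with fiber $\mathbf{F}_\sigma\subset\mathrm{U}(r)/\mathrm{Stab}(\sigma)$ and with base the set of those $\{\lambda_1,\dots,\lambda_r\}\in\mathrm{Sym}^r_\sigma(S^1)$ such that $\lambda_1^n=\lambda_2^n=\cdots=\lambda_r^n$.
   Context: $\Gamma_n=\langle a,b\mid [a^n,b]=1\rangle$; a representation $\Gamma_n\to\mathrm{U}(r)$ is a pair $(A,B)\in\mathrm{U}(r)^2$ with $[A^n,B]=\mathrm{id}$; it is irreducible if no proper nonzero subspace of $\mathbb{C}^r$ is invariant under both $A$ and $B$. $X_r^*$ is the space of irreducible representations $\Gamma_n\to\mathrm{U}(r)$ modulo simultaneous $\mathrm{U}(r)$-conjugation, with the quotient topology. A partition $\sigma$ of $r$ is $\sigma=(r_1,\overset{(a_1)}{\ldots},r_1,\ldots,r_s,\overset{(a_s)}{\ldots},r_s)$ with $r=a_1r_1+\cdots+a_sr_s$, $r_1>\cdots>r_s>0$, $a_i\ge1$. Let $\mathrm{Sym}^r(S^1)=(S^1)^r/S_r$, and let $\mathrm{Sym}^r_\sigma(S^1)$ be the subset of those $\{\lambda_1,\dots,\lambda_r\}$ in which exactly $a_i$ distinct values occur with multiplicity $r_i$, $i=1,\dots,s$. $X_\sigma^*\subset X_r^*$ is the subspace of classes of $(A,B)$ such that the eigenvalues of $A$ form an element of $\mathrm{Sym}^r_\sigma(S^1)$.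 Fix $\{\lambda_1,\dots,\lambda_r\}\in\mathrm{Sym}^r_\sigma(S^1)$, ordered so that equal values are grouped in consecutive blocks of sizes given by $\sigma$, and set $A_\sigma=\mathrm{diag}(\lambda_1,\dots,\lambda_r)$. $\mathrm{Stab}(\sigma)$ is the stabilizer (centralizer) of $A_\sigma$ in $\mathrm{U}(r)$ under conjugation (independent of the choice of values), acting on $\mathrm{U}(r)$ by conjugation. $\mathbf{F}_\sigma\subset\mathrm{U}(r)/\mathrm{Stab}(\sigma)$ is the image of the set of those $B\in\mathrm{U}(r)$ that have no proper nonzero invariant subspace in common with $A_\sigma$ (this set depends only on $\sigma$). "Zariski locally trivial" means that every point of the base has a neighbourhood $U$, open in the (real) Zariski topology of the base, over which the map is isomorphic, as a map of topological spaces, to the projection $U\times(\text{fiber})\to U$. The fiber may be empty for some $\sigma$. *)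

theory Defs
  imports
    "HOL-Analysis.Analysis"
    "HOL-Computational_Algebra.Polynomial"
    "HOL-Combinatorics.Permutations"
begin

text \<open>Throughout, \<open>r\<close> is the cardinality of the index type \<open>'r\<close>.\<close>


section \<open>Matrices\<close>

definition adj :: "complex^'r^'r \<Rightarrow> complex^'r^'r" where
  "adj A = (\<chi> i j. cnj (A $ j $ i))"

definition unitary_group :: "(complex^'r^'r) set" where
  "unitary_group = {A. A ** adj A = mat 1 \<and> adj A ** A = mat 1}"

text \<open>The operation \<open>(^)\<close> on vectors and matrices is the componentwise power, hence this definition.\<close>

definition mpow :: "complex^'r^'r \<Rightarrow> nat \<Rightarrow> complex^'r^'r" where
  "mpow A n = (((**) A) ^^ n) (mat 1)"

definition commutator :: "complex^'r^'r \<Rightarrow> complex^'r^'r \<Rightarrow> complex^'r^'r" where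
  "commutator A B = A ** B ** matrix_inv A ** matrix_inv B"

definition diag :: "complex^'r \<Rightarrow> complex^'r^'r" where
  "diag l = (\<chi> i j. if i = j then l $ i else 0)"

definition charpoly :: "complex^'r^'r \<Rightarrow> complex poly" where
  "charpoly A = det (\<chi> i j. if i = j then [:- (A $ i $ j), 1:] else [:- (A $ i $ j):])"

text \<open>\<^const>\<open>vec.subspace\<close> refers to linear subspaces over the complex numbers here.\<close>

definition irreducible_pair :: "complex^'r^'r \<Rightarrow> complex^'r^'r \<Rightarrow> bool" where
  "irreducible_pair A B \<longleftrightarrow>
     (\<forall>W. vec.subspace W \<and> (\<forall>w\<in>W. A *v w \<in> W) \<and> (\<forall>w\<in>W. B *v w \<in> W)
        \<longrightarrow> W = {0} \<or> W = UNIV)"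


section \<open>Quotient topologies\<close>

definition quot_topology :: "'a topology \<Rightarrow> ('a \<Rightarrow> 'b) \<Rightarrow> 'b topology" where
  "quot_topology X q =
     topology (\<lambda>U. U \<subseteq> q ` topspace X \<and> openin X {x \<in> topspace X. q x \<in> U})"

lemma openin_quot_topology:
  "openin (quot_topology X q) U \<longleftrightarrow>
     U \<subseteq> q ` topspace X \<and> openin X {x \<in> topspace X. q x \<in> U}"
proof -
  have "istopology (\<lambda>U. U \<subseteq> q ` topspace X \<and> openin X {x \<in> topspace X. q x \<in> U})"
    unfolding istopology_def
  proof (intro conjI allI impI)
    fix S T
    assume S: "S \<subseteq> q ` topspace X \<and> openin X {x \<in> topspace X. q x \<in> S}"
      and T: "T \<subseteq> q ` topspace X \<and> openin X {x \<in> topspace X. q x \<in> T}"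
    have eq: "{x \<in> topspace X. q x \<in> S \<inter> T} =
        {x \<in> topspace X. q x \<in> S} \<inter> {x \<in> topspace X. q x \<in> T}"
      by blast
    show "openin X {x \<in> topspace X. q x \<in> S \<inter> T}"
      unfolding eq using S T by blast
    show "S \<inter> T \<subseteq> q ` topspace X"
      using S by blast
  next
    fix K
    assume K: "\<forall>U\<in>K. U \<subseteq> q ` topspace X \<and> openin X {x \<in> topspace X. q x \<in> U}"
    have eq: "{x \<in> topspace X. q x \<in> \<Union>K} = (\<Union>U\<in>K. {x \<in> topspace X. q x \<in> U})"
      by blast
    show "openin X {x \<in> topspace X. q x \<in> \<Union>K}"
      unfolding eq using K by blast
    show "\<Union>K \<subseteq> q ` topspace X"
      using K by blast
  qed
  then show ?thesis
    unfolding quot_topology_def by simp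
qed

lemma topspace_quot_topology: "topspace (quot_topology X q) = q ` topspace X"
proof
  show "topspace (quot_topology X q) \<subseteq> q ` topspace X"
    using openin_quot_topology[of X q] openin_topspace by blast
  have "{x \<in> topspace X. q x \<in> q ` topspace X} = topspace X"
    by blast
  then have "openin (quot_topology X q) (q ` topspace X)"
    by (simp add: openin_quot_topology)
  then show "q ` topspace X \<subseteq> topspace (quot_topology X q)"
    by (rule openin_subset)
qed

lemma quotient_map_quot_topology: "quotient_map X (quot_topology X q) q"
  unfolding quotient_map_def by (auto simp: topspace_quot_topology openin_quot_topology)


section \<open>Unordered tuples on the circle\<close>

definition torus :: "(complex^'r) set" where
  "torus = {l. \<forall>i. l $ i \<in> sphere 0 1}"

definition unordered :: "complex^'r \<Rightarrow> (complex^'r) set" where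
  "unordered l = {(\<chi> i. l $ p i) | p. p permutes UNIV}"

definition sym_topology :: "(complex^'r) set topology" where
  "sym_topology = quot_topology (top_of_set torus) unordered"

definition zariski_torus :: "(complex^'r) topology" where
  "zariski_torus = topology (\<lambda>U. \<exists>P. (\<forall>p\<in>P. real_polynomial_function p) \<and>
     U = torus - {l \<in> torus. \<forall>p\<in>P. p l = 0})"

lemma openin_zariski_torus:
  fixes U :: "(complex^'r) set"
  shows "openin zariski_torus U \<longleftrightarrow> (\<exists>P. (\<forall>p\<in>P. real_polynomial_function p) \<and>
     U = torus - {l \<in> torus. \<forall>p\<in>P. p l = 0})"
proof -
  have "istopology (\<lambda>U :: (complex^'r) set. \<exists>P. (\<forall>p\<in>P. real_polynomial_function p) \<and>
     U = torus - {l \<in> torus. \<forall>p\<in>P. p l = 0})" (is "istopology ?Z")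
    unfolding istopology_def
  proof (intro conjI allI impI)
    fix S T assume "?Z S" "?Z T"
    then obtain P Q where P: "\<forall>p\<in>P. real_polynomial_function p"
        "S = torus - {l \<in> torus. \<forall>p\<in>P. p l = 0}"
      and Q: "\<forall>q\<in>Q. real_polynomial_function q"
        "T = torus - {l \<in> torus. \<forall>q\<in>Q. q l = 0}"
      by blast
    show "?Z (S \<inter> T)"
    proof (intro exI conjI)
      show "\<forall>f \<in> {\<lambda>l. p l * q l | p q. p \<in> P \<and> q \<in> Q}. real_polynomial_function f"
        using P(1) Q(1) by blast
      show "S \<inter> T = torus - {l \<in> torus. \<forall>f\<in>{\<lambda>l. p l * q l | p q. p \<in> P \<and> q \<in> Q}. f l = 0}"
        unfolding P(2) Q(2) by fastforce
    qed
  next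
    fix K assume "\<forall>U\<in>K. ?Z U"
    from bchoice[OF this] obtain P where P: "\<forall>U\<in>K. (\<forall>p\<in>P U. real_polynomial_function p) \<and>
        U = torus - {l \<in> torus. \<forall>p\<in>P U. p l = 0}"
      by (elim exE)
    show "?Z (\<Union>K)"
    proof (intro exI conjI)
      show "\<forall>p\<in>(\<Union>U\<in>K. P U). real_polynomial_function p"
        using P by blast
      show "\<Union>K = torus - {l \<in> torus. \<forall>p\<in>(\<Union>U\<in>K. P U). p l = 0}" (is "_ = ?R")
      proof
        show "\<Union>K \<subseteq> ?R"
        proof
          fix l assume "l \<in> \<Union>K"
          then obtain U where U: "U \<in> K" "l \<in> U"
            by blast
          with P have "l \<in> torus - {l \<in> torus. \<forall>p\<in>P U. p l = 0}"
            by blast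
          with U(1) show "l \<in> ?R"
            by blast
        qed
        show "?R \<subseteq> \<Union>K"
        proof
          fix l assume "l \<in> ?R"
          then obtain U p where "l \<in> torus" "U \<in> K" "p \<in> P U" "p l \<noteq> 0" by blast
          then have "l \<in> torus - {l \<in> torus. \<forall>p\<in>P U. p l = 0}" by blast
          then show "l \<in> \<Union>K" using P \<open>U \<in> K\<close> by blast
        qed
      qed
    qed
  qed
  then show ?thesis
    unfolding zariski_torus_def by simp
qed

text \<open>The real Zariski topology on \<open>(S\<^sup>1)\<^sup>r / S\<^sub>r\<close>. As \<open>S\<^sub>r\<close> is finite, every \<open>S\<^sub>r\<close>-invariant real algebraic
  subset of the torus is cut out by \<open>S\<^sub>r\<close>-invariant real polynomials, so the quotient of the Zariski
  topology is the topology given by the zero sets of the symmetric polynomials in the real and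
  imaginary parts.\<close>

definition zariski_sym :: "(complex^'r) set topology" where
  "zariski_sym = quot_topology zariski_torus unordered"


section \<open>Partitions\<close>

definition is_partition :: "nat list \<Rightarrow> nat \<Rightarrow> bool" where
  "is_partition \<sigma> r \<longleftrightarrow> sorted_wrt (\<ge>) \<sigma> \<and> (\<forall>k\<in>set \<sigma>. k > 0) \<and> sum_list \<sigma> = r"

text \<open>For a part \<open>k = r\<^sub>i\<close>, the number \<open>a\<^sub>i\<close> is \<open>count_list \<sigma> k\<close>.\<close>

definition has_type :: "nat list \<Rightarrow> complex^'r \<Rightarrow> bool" where
  "has_type \<sigma> l \<longleftrightarrow> (\<forall>k\<in>set \<sigma>. card {z. card {i. l $ i = z} = k} = count_list \<sigma> k)"

definition sym_sigma :: "nat list \<Rightarrow> (complex^'r) set set" where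
  "sym_sigma \<sigma> = unordered ` {l \<in> torus. has_type \<sigma> l}"

definition base_set :: "nat \<Rightarrow> nat list \<Rightarrow> (complex^'r) set set" where
  "base_set n \<sigma> = {c \<in> sym_sigma \<sigma>. \<forall>l\<in>c. \<forall>i j. (l $ i) ^ n = (l $ j) ^ n}"

definition position :: "'r::{finite,wellorder} \<Rightarrow> nat" where
  "position i = card {j. j < i}"

text \<open>The index of the block containing the position \<open>p < sum_list \<sigma>\<close>, where the positions are cut
  into consecutive blocks of sizes \<open>\<sigma> ! 0\<close>, \<open>\<sigma> ! 1\<close>, and so on.\<close>

definition block :: "nat list \<Rightarrow> nat \<Rightarrow> nat" where
  "block \<sigma> p = (LEAST b. p < sum_list (take (Suc b) \<sigma>))"

definition block_ordered :: "nat list \<Rightarrow> complex^'r::{finite,wellorder} \<Rightarrow> bool" where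
  "block_ordered \<sigma> l \<longleftrightarrow>
     (\<forall>i j. l $ i = l $ j \<longleftrightarrow> block \<sigma> (position i) = block \<sigma> (position j))"


section \<open>Spaces of irreducible representations and the eigenvalue map\<close>

definition irreps :: "nat \<Rightarrow> ((complex^'r^'r) \<times> (complex^'r^'r)) set" where
  "irreps n = {(A, B). A \<in> unitary_group \<and> B \<in> unitary_group \<and>
     commutator (mpow A n) B = mat 1 \<and> irreducible_pair A B}"

definition conj_class :: "(complex^'r^'r) \<times> (complex^'r^'r) \<Rightarrow> ((complex^'r^'r) \<times> (complex^'r^'r)) set" where
  "conj_class = (\<lambda>(A, B). {(g ** A ** adj g, g ** B ** adj g) | g. g \<in> unitary_group})"

definition X_star :: "nat \<Rightarrow> ((complex^'r^'r) \<times> (complex^'r^'r)) set topology" where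
  "X_star n = quot_topology (top_of_set (irreps n)) conj_class"

text \<open>The roots of the characteristic polynomial with multiplicities, as an unordered tuple.\<close>

definition eigvals :: "complex^'r^'r \<Rightarrow> (complex^'r) set" where
  "eigvals A = {l. charpoly A = (\<Prod>i\<in>UNIV. [:- (l $ i), 1:])}"

lemma eigvals_eq_unordered:
  fixes A :: "complex^'r^'r"
  assumes "l \<in> eigvals A"
  shows "eigvals A = unordered l"
proof
  let ?m = "\<lambda>l::complex^'r. image_mset (($) l) (mset_set UNIV)"
  have ms: "proots (\<Prod>i\<in>UNIV. [:- (x $ i), 1:]) = ?m x" for x :: "complex^'r"
  proof -
    have "(\<Prod>i\<in>UNIV. [:- (x $ i), 1:]) = (\<Prod>p\<in>#image_mset (\<lambda>i. [:- (x $ i), 1:]) (mset_set UNIV). p)"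
      by (simp add: prod_unfold_prod_mset)
    moreover have "proots (\<Prod>i\<in>UNIV. [:- (x $ i), 1:]) = (\<Sum>i\<in>UNIV. proots [:- (x $ i), 1:])"
      by (rule proots_prod) auto
    moreover have "(\<Sum>i\<in>S. {#x $ i#}) = image_mset (($) x) (mset_set S)" if "finite S" for S
      using that by induction auto
    ultimately show ?thesis by simp
  qed
  show "eigvals A \<subseteq> unordered l"
  proof
    fix x assume "x \<in> eigvals A"
    then have "?m x = ?m l"
      using assms ms by (metis (mono_tags, lifting) eigvals_def mem_Collect_eq)
    then obtain p where p: "p permutes UNIV" "\<forall>i. x $ i = l $ p i"
      using image_mset_eq_implies_permutes[of UNIV "($) x" "($) l"] by auto
    then have "x = (\<chi> i. l $ p i)"
      by (simp add: vec_eq_iff)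
    with p(1) show "x \<in> unordered l"
      unfolding unordered_def by blast
  qed
  show "unordered l \<subseteq> eigvals A"
  proof
    fix x assume "x \<in> unordered l"
    then obtain p where p: "p permutes UNIV" "x = (\<chi> i. l $ p i)"
      unfolding unordered_def by blast
    have "(\<Prod>i\<in>UNIV. [:- (x $ i), 1:]) = (\<Prod>i\<in>UNIV. [:- (l $ i), 1:])"
      using prod.permute[OF p(1), of "\<lambda>i. [:- (l $ i), 1:]"] p(2) by (simp add: comp_def)
    then show "x \<in> eigvals A"
      using assms by (simp add: eigvals_def)
  qed
qed

definition X_sigma :: "nat \<Rightarrow> nat list \<Rightarrow> ((complex^'r^'r) \<times> (complex^'r^'r)) set topology" where
  "X_sigma n \<sigma> = subtopology (X_star n)
     {conj_class (A, B) | A B. (A, B) \<in> irreps n \<and> eigvals A \<in> sym_sigma \<sigma>}"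

text \<open>By conjugation invariance, the set of which \<^const>\<open>the_elem\<close> is taken is a singleton for every
  conjugacy class (shown below).\<close>

definition omega :: "((complex^'r^'r) \<times> (complex^'r^'r)) set \<Rightarrow> (complex^'r) set" where
  "omega c = the_elem ((\<lambda>(A, B). eigvals A) ` c)"

definition cpoly_mat :: "complex^'r^'r \<Rightarrow> complex poly^'r^'r" where
  "cpoly_mat A = (\<chi> i j. [:A $ i $ j:])"

lemma cpoly_mat_mult:
  fixes A B :: "complex^'r^'r"
  shows "cpoly_mat (A ** B) = cpoly_mat A ** cpoly_mat B"
proof -
  have sum: "[:\<Sum>k\<in>S. f k:] = (\<Sum>k\<in>S. [:f k:])" if "finite S" for S :: "'r set" and f :: "'r \<Rightarrow> complex"
    using that
  proof (induction rule: finite_induct)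
    case (insert x F)
    have "[:f x + sum f F:] = [:f x:] + [:sum f F:]"
      by simp
    then show ?case
      using insert by (metis sum.insert)
  qed simp
  have "[:\<Sum>k\<in>UNIV. A $ i $ k * B $ k $ j:] = (\<Sum>k\<in>UNIV. [:A $ i $ k:] * [:B $ k $ j:])" for i j
  proof -
    have "[:A $ i $ k:] * [:B $ k $ j:] = [:A $ i $ k * B $ k $ j:]" for k
      by simp
    then show ?thesis
      using sum[OF finite_class.finite_UNIV, of "\<lambda>k. A $ i $ k * B $ k $ j"] by (simp only:)
  qed
  then have "cpoly_mat (A ** B) $ i $ j = (cpoly_mat A ** cpoly_mat B) $ i $ j" for i j
    unfolding cpoly_mat_def matrix_matrix_mult_def vec_lambda_beta by blast
  then show ?thesis
    unfolding vec_eq_iff by blast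
qed

lemma charpoly_conj:
  fixes A :: "complex^'r^'r"
  assumes "g \<in> unitary_group"
  shows "charpoly (g ** A ** adj g) = charpoly A"
proof -
  have ch: "charpoly C = det (mat [:0, 1:] - cpoly_mat C)" for C :: "complex^'r^'r"
    unfolding charpoly_def cpoly_mat_def
    by (rule arg_cong[of _ _ det]) (simp add: vec_eq_iff mat_def)
  have gg: "cpoly_mat g ** cpoly_mat (adj g) = mat 1"
    using assms
    by (simp add: unitary_group_def flip: cpoly_mat_mult)
       (simp add: cpoly_mat_def mat_def vec_eq_iff pCons_one)
  have sc: "P ** mat [:0, 1:] = mat [:0, 1:] ** P" for P :: "complex poly^'r^'r"
  proof -
    have "P ** mat c = (\<chi> i j. P $ i $ j * c)" "mat c ** P = (\<chi> i j. c * P $ i $ j)" for c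
      by (simp_all add: matrix_matrix_mult_def mat_def vec_eq_iff mult_delta_left mult_delta_right)
    then show ?thesis
      by (simp add: vec_eq_iff)
  qed
  have "mat [:0, 1:] - cpoly_mat (g ** A ** adj g) =
      cpoly_mat g ** (mat [:0, 1:] - cpoly_mat A) ** cpoly_mat (adj g)"
  proof -
    have sub: "P ** (Q - R) = P ** Q - P ** R" "(Q - R) ** P = Q ** P - R ** P"
      for P Q R :: "complex poly^'r^'r"
      by (simp_all only: matrix_matrix_mult_def vec_eq_iff vec_lambda_beta vector_minus_component
          right_diff_distrib left_diff_distrib sum_subtractf simp_thms)
    have "cpoly_mat g ** mat [:0, 1:] ** cpoly_mat (adj g) = mat [:0, 1:]"
      by (metis gg sc matrix_mul_assoc matrix_mul_rid)
    then show ?thesis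
      by (simp add: cpoly_mat_mult sub)
  qed
  then have "charpoly (g ** A ** adj g) =
      det (cpoly_mat g) * charpoly A * det (cpoly_mat (adj g))"
    by (simp add: ch det_mul)
  also have "\<dots> = det (cpoly_mat g ** cpoly_mat (adj g)) * charpoly A"
    by (simp add: det_mul)
  finally show ?thesis
    by (simp add: gg)
qed

lemma omega_conj_class:
  fixes A B :: "complex^'r^'r"
  shows "omega (conj_class (A, B)) = eigvals A"
proof -
  have "adj (mat 1 :: complex^'r^'r) = mat 1"
    by (simp add: adj_def mat_def vec_eq_iff)
  then have "mat 1 \<in> (unitary_group :: (complex^'r^'r) set)"
    by (simp add: unitary_group_def)
  moreover have "eigvals (g ** A ** adj g) = eigvals A" if "g \<in> unitary_group" for g
    using that by (simp add: eigvals_def charpoly_conj)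
  moreover have "(\<lambda>(A, B). eigvals A) ` conj_class (A, B) =
      (\<lambda>g. eigvals (g ** A ** adj g)) ` unitary_group"
    by (force simp: conj_class_def)
  ultimately have "(\<lambda>(A, B). eigvals A) ` conj_class (A, B) = {eigvals A}"
    by auto
  then show ?thesis
    by (simp add: omega_def)
qed


section \<open>The fiber\<close>

text \<open>For a block-ordered tuple \<open>l\<close> on the circle, \<open>diag l\<close> is the matrix \<open>A\<^sub>\<sigma>\<close>. Its centralizer and its
  invariant subspaces depend only on which entries of \<open>l\<close> coincide, that is, on \<open>\<sigma>\<close>.\<close>

definition Stab :: "complex^'r \<Rightarrow> (complex^'r^'r) set" where
  "Stab l = {g \<in> unitary_group. g ** diag l ** adj g = diag l}"

definition stab_class :: "complex^'r \<Rightarrow> complex^'r^'r \<Rightarrow> (complex^'r^'r) set" where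
  "stab_class l B = {g ** B ** adj g | g. g \<in> Stab l}"

definition F_fiber :: "complex^'r \<Rightarrow> (complex^'r^'r) set topology" where
  "F_fiber l = subtopology (quot_topology (top_of_set unitary_group) (stab_class l))
     (stab_class l ` {B \<in> unitary_group. irreducible_pair (diag l) B})"


section \<open>Zariski local triviality\<close>

text \<open>\<open>B\<close> is the base with its ordinary topology, \<open>Z\<close> is its Zariski topology.\<close>

definition zariski_locally_trivial ::
  "'e topology \<Rightarrow> 'b topology \<Rightarrow> 'b topology \<Rightarrow> 'f topology \<Rightarrow> ('e \<Rightarrow> 'b) \<Rightarrow> bool" where
  "zariski_locally_trivial E B Z F f \<longleftrightarrow>
     continuous_map E B f \<and> topspace Z = topspace B \<and>
     (\<forall>b\<in>topspace B. \<exists>U. openin Z U \<and> b \<in> U \<and>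
        (\<exists>h. homeomorphic_map (subtopology E {x \<in> topspace E. f x \<in> U})
               (prod_topology (subtopology B U) F) h \<and>
             (\<forall>x\<in>topspace E. f x \<in> U \<longrightarrow> fst (h x) = f x)))"

end

theory Submission
  imports Defs "HOL-Computational_Algebra.Fundamental_Theorem_Algebra"
begin

text \<open>An irreducible representation \<open>(A, B)\<close> forces \<open>A\<^sup>n\<close> to be a scalar: after diagonalizing \<open>A\<close>, an eigenspace
of \<open>A\<^sup>n\<close> is invariant under both matrices. Conversely, if the eigenvalues of a unitary \<open>A\<close> have a common
\<open>n\<close>-th power, then \<open>A\<^sup>n\<close> is scalar and every unitary \<open>B\<close> satisfies the relation (\<open>irreps_diag_iff\<close>). So over
the base the only condition left on \<open>B\<close> is irreducibility, and for diagonal \<open>A\<close> this depends only on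
which eigenvalues coincide (\<open>irreducible_pair_diag_cong\<close>).

The bundle is therefore trivial over every set \<open>U\<close> of base points on which the eigenvalues can be
ordered continuously with the coincidence pattern of \<open>l\<close>, that is, over which there is a continuous section
\<open>s\<close> from unordered to ordered tuples: a class over \<open>u\<close> contains pairs \<open>(diag (s u), C)\<close>, and
the possible \<open>C\<close> form exactly one orbit of the stabilizer (\<open>omega_trivial_over_section\<close>).

Such a section exists over a Zariski neighbourhood of any point. Tuples in the base have a common
\<open>n\<close>-th power \<open>c\<close>, a point of the circle. Excluding one value of \<open>c\<close> is a Zariski open condition, and on
the rest of the circle there is a continuous \<open>n\<close>-th root \<open>\<mu>\<close> of \<open>c\<close>. Dividing a tuple by \<open>\<mu>\<close> gives a tuple
of \<open>n\<close>-th roots of unity, of which there are finitely many; an ordering can be chosen for each of them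
separately, and multiplying by \<open>\<mu>\<close> again gives the section (\<open>base_section\<close>).

Continuity of the trivialization and of the eigenvalue map rests on two facts. Quotient maps by group
actions are open, hence remain quotient maps after restriction to saturated subsets and after taking
products. The map \<open>(g, x, B) \<mapsto> (g diag(x) g\<^sup>*, g B g\<^sup>*)\<close>, where \<open>g\<close> and \<open>B\<close> are unitary and \<open>x\<close> is in the
torus, is closed by compactness and surjective by the spectral theorem, so continuity may be checked
after composing with it, where eigenvalues are visible coordinates.\<close>

section \<open>Quotients by group actions\<close>

text \<open>The group structure enters only through the existence of unit, products and inverses on the level
of the action, so that permutations and matrices need no common algebraic framework.\<close>
lemma orbit_eq_iff:
  assumes "\<exists>e\<in>G. \<forall>x. a e x = x"
    and "\<And>g h. \<lbrakk>g \<in> G; h \<in> G\<rbrakk> \<Longrightarrow> \<exists>k\<in>G. \<forall>x. a g (a h x) = a k x"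
    and "\<And>g. g \<in> G \<Longrightarrow> \<exists>h\<in>G. \<forall>x. a h (a g x) = x"
  shows "{a g x | g. g \<in> G} = {a g y | g. g \<in> G} \<longleftrightarrow> (\<exists>g\<in>G. a g x = y)"
proof
  assume "{a g x | g. g \<in> G} = {a g y | g. g \<in> G}"
  then have "y \<in> {a g x | g. g \<in> G}" using assms(1) by force
  then show "\<exists>g\<in>G. a g x = y" by blast
next
  have sub: "{a g (a k z) | g. g \<in> G} \<subseteq> {a g z | g. g \<in> G}" if "k \<in> G" for k z
    using assms(2)[OF _ that] by (smt (verit, best) mem_Collect_eq subsetI)
  assume "\<exists>g\<in>G. a g x = y"
  then obtain g h where g: "g \<in> G" "a g x = y" and h: "h \<in> G" "a h y = x"
    using assms(3) by metis
  show "{a g x | g. g \<in> G} = {a g y | g. g \<in> G}"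
    using sub[OF g(1), of x] sub[OF h(1), of y] g h by auto
qed

text \<open>The saturation of an open set is the union of its preimages under the elements of the group.\<close>
lemma open_map_orbit_quotient:
  assumes cont: "\<And>g. g \<in> G \<Longrightarrow> continuous_map X X (a g)"
    and orbit: "\<And>x y. \<lbrakk>x \<in> topspace X; y \<in> topspace X\<rbrakk> \<Longrightarrow> q x = q y \<longleftrightarrow> (\<exists>g\<in>G. a g x = y)"
  shows "open_map X (quot_topology X q) q"
  unfolding open_map_def
proof (intro allI impI)
  fix U assume U: "openin X U"
  then have sub: "U \<subseteq> topspace X" by (rule openin_subset)
  have "{x \<in> topspace X. q x \<in> q ` U} = (\<Union>g\<in>G. {x \<in> topspace X. a g x \<in> U})"
    using orbit sub by (force simp: image_iff)
  moreover have "openin X (\<Union>g\<in>G. {x \<in> topspace X. a g x \<in> U})"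
    using cont U by (blast intro: openin_continuous_map_preimage)
  ultimately show "openin (quot_topology X q) (q ` U)"
    using sub by (simp add: openin_quot_topology image_mono)
qed

text \<open>A quotient map need not stay one on an arbitrary saturated subset; an open one does.\<close>
lemma quotient_map_restrict_open:
  assumes open_q: "open_map X (quot_topology X q) q"
    and S: "{x \<in> topspace X. q x \<in> V} = S"
  shows "open_map (subtopology X S) (subtopology (quot_topology X q) V) q"
    and "quotient_map (subtopology X S) (subtopology (quot_topology X q) V) q"
proof -
  show open_r: "open_map (subtopology X S) (subtopology (quot_topology X q) V) q"
    using open_q S by (rule open_map_restriction)
  have "continuous_map X (quot_topology X q) q"
    by (intro quotient_imp_continuous_map quotient_map_quot_topology)
  then have "continuous_map (subtopology X S) (subtopology (quot_topology X q) V) q"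
    using S by (intro continuous_map_into_subtopology continuous_map_from_subtopology) auto
  then show "quotient_map (subtopology X S) (subtopology (quot_topology X q) V) q"
    using open_r S by (intro continuous_open_imp_quotient_map) (auto simp: topspace_quot_topology)
qed

lemma open_map_prod:
  assumes "open_map X X' f" and "open_map Y Y' g"
  shows "open_map (prod_topology X Y) (prod_topology X' Y') (\<lambda>(x, y). (f x, g y))"
  unfolding open_map_def
proof (intro allI impI)
  fix W assume W: "openin (prod_topology X Y) W"
  show "openin (prod_topology X' Y') ((\<lambda>(x, y). (f x, g y)) ` W)"
    unfolding openin_prod_topology_alt
  proof (intro allI impI)
    fix u v assume "(u, v) \<in> (\<lambda>(x, y). (f x, g y)) ` W"
    then obtain x y where xy: "(x, y) \<in> W" "u = f x" "v = g y" by auto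
    then obtain S T where "openin X S" "openin Y T" "x \<in> S" "y \<in> T" "S \<times> T \<subseteq> W"
      using W unfolding openin_prod_topology_alt by meson
    then show "\<exists>U V. openin X' U \<and> openin Y' V \<and> u \<in> U \<and> v \<in> V \<and>
        U \<times> V \<subseteq> (\<lambda>(x, y). (f x, g y)) ` W"
      using assms xy unfolding open_map_def
      by (intro exI[of _ "f ` S"] exI[of _ "g ` T"]) force
  qed
qed

section \<open>Unitary matrices\<close>

lemma adj_adj [simp]: "adj (adj A) = A"
  by (simp add: adj_def vec_eq_iff)

lemma adj_mult: "adj (A ** B) = adj B ** adj A"
  by (simp add: adj_def matrix_matrix_mult_def vec_eq_iff mult.commute)

lemma adj_one [simp]: "adj (mat 1) = mat 1"
  by (simp add: adj_def mat_def vec_eq_iff)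

lemma unitary_one [simp]: "mat 1 \<in> unitary_group"
  by (simp add: unitary_group_def)

lemma unitary_adj: "g \<in> unitary_group \<Longrightarrow> adj g \<in> unitary_group"
  by (simp add: unitary_group_def)

lemma unitary_cancel:
  assumes "g \<in> unitary_group"
  shows "g ** adj g = mat 1" "adj g ** g = mat 1"
    "g ** (adj g ** A) = A" "adj g ** (g ** A) = A" "A ** g ** adj g = A" "A ** adj g ** g = A"
    "g *v (adj g *v v) = v" "adj g *v (g *v v) = v"
proof -
  show 1: "g ** adj g = mat 1" "adj g ** g = mat 1"
    using assms by (simp_all add: unitary_group_def)
  show "g ** (adj g ** A) = A" "adj g ** (g ** A) = A" 
    by (simp_all add: matrix_mul_assoc 1)
  show "A ** g ** adj g = A" "A ** adj g ** g = A"
    by (simp_all add: 1 flip: matrix_mul_assoc)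
  show "g *v (adj g *v v) = v" "adj g *v (g *v v) = v"
    by (simp_all add: matrix_vector_mul_assoc 1)
qed

lemma unitary_mult:
  assumes "g \<in> unitary_group" "h \<in> unitary_group"
  shows "g ** h \<in> unitary_group"
proof -
  have "g ** h ** (adj h ** adj g) = g ** (h ** adj h) ** adj g"
    "adj h ** adj g ** (g ** h) = adj h ** (adj g ** g) ** h"
    by (simp_all only: matrix_mul_assoc)
  then show ?thesis
    using assms by (simp add: unitary_group_def adj_mult)
qed

lemma unitary_conj: "\<lbrakk>g \<in> unitary_group; A \<in> unitary_group\<rbrakk> \<Longrightarrow> g ** A ** adj g \<in> unitary_group"
  by (intro unitary_mult unitary_adj)

lemma conj_conj: "g ** (h ** A ** adj h) ** adj g = (g ** h) ** A ** adj (g ** h)"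
  by (simp add: adj_mult matrix_mul_assoc)

lemma conj_inverse:
  assumes "g \<in> unitary_group"
  shows "adj g ** (g ** A ** adj g) ** g = A"
proof -
  have "adj g ** (g ** A ** adj g) ** g = (adj g ** g) ** A ** (adj g ** g)"
    by (simp only: matrix_mul_assoc)
  then show ?thesis using assms by (simp add: unitary_cancel)
qed

lemma continuous_on_matrix_mult [continuous_intros]:
  fixes f g :: "'a::topological_space \<Rightarrow> complex^'r^'r"
  assumes "continuous_on S f" "continuous_on S g"
  shows "continuous_on S (\<lambda>x. f x ** g x)"
  unfolding matrix_matrix_mult_def using assms
  by (intro continuous_intros)

lemma continuous_on_adj [continuous_intros]:
  fixes f :: "'a::topological_space \<Rightarrow> complex^'r^'r"
  assumes "continuous_on S f"
  shows "continuous_on S (\<lambda>x. adj (f x))"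
  unfolding adj_def using assms by (intro continuous_intros)

lemma continuous_on_diag [continuous_intros]:
  fixes f :: "'a::topological_space \<Rightarrow> complex^'r"
  assumes "continuous_on S f"
  shows "continuous_on S (\<lambda>x. diag (f x))"
proof -
  have "continuous_on S (\<lambda>x. if i = j then f x $ i else 0)" for i j :: 'r
    using assms by (cases "i = j") (auto intro!: continuous_intros)
  then show ?thesis
    unfolding diag_def by (intro continuous_intros)
qed

text \<open>Used for the boundedness of the unitary group, and so for its compactness.\<close>
lemma unitary_norm_row:
  assumes "g \<in> unitary_group"
  shows "norm (g $ i) = 1"
proof -
  have "(g ** adj g) $ i $ i = 1"
    using assms by (simp add: unitary_group_def mat_def)
  then have "(\<Sum>j\<in>UNIV. complex_of_real ((norm (g $ i $ j))\<^sup>2)) = 1"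
    by (simp add: matrix_matrix_mult_def adj_def flip: complex_norm_square)
  then have "(\<Sum>j\<in>UNIV. (norm (g $ i $ j))\<^sup>2) = 1"
    by (metis of_real_eq_1_iff of_real_sum)
  then show ?thesis
    by (simp add: norm_vec_def L2_set_def)
qed

lemma compact_unitary_group: "compact (unitary_group :: (complex^'r^'r) set)"
proof -
  have "norm g \<le> real CARD('r)" if "g \<in> unitary_group" for g :: "complex^'r^'r"
    using L2_set_le_sum[of UNIV "\<lambda>i. norm (g $ i)"] that
    by (simp add: norm_vec_def[of g] unitary_norm_row)
  then have "bounded (unitary_group :: (complex^'r^'r) set)"
    by (auto simp: bounded_iff)
  moreover have "closed (unitary_group :: (complex^'r^'r) set)"
    unfolding unitary_group_def
    by (intro closed_Collect_conj closed_Collect_eq continuous_intros)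
  ultimately show ?thesis by (simp add: compact_eq_bounded_closed)
qed

lemma compact_torus: "compact (torus :: (complex^'r) set)"
proof -
  have "norm x \<le> real CARD('r)" if "x \<in> torus" for x :: "complex^'r"
    using L2_set_le_sum[of UNIV "\<lambda>i. norm (x $ i)"] that
    by (simp add: norm_vec_def[of x] torus_def)
  then have "bounded (torus :: (complex^'r) set)"
    by (auto simp: bounded_iff)
  moreover have "closed (torus :: (complex^'r) set)"
    unfolding torus_def sphere_def mem_Collect_eq dist_norm
    by (intro closed_Collect_all closed_Collect_eq continuous_intros)
  ultimately show ?thesis by (simp add: compact_eq_bounded_closed)
qed

lemma diag_mult_vec: "diag x *v v = (\<chi> i. x $ i * v $ i)"
  by (simp add: diag_def matrix_vector_mult_def vec_eq_iff mult_delta_left)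

lemma diag_mult_entry:
  "(diag x ** A) $ i $ j = x $ i * A $ i $ j" "(A ** diag x) $ i $ j = A $ i $ j * x $ j"
  by (simp_all add: diag_def matrix_matrix_mult_def mult_delta_left mult_delta_right)

lemma diag_unitary_iff: "diag x \<in> unitary_group \<longleftrightarrow> x \<in> torus"
proof -
  have "adj (diag x) = diag (\<chi> i. cnj (x $ i))"
    by (auto simp: adj_def diag_def vec_eq_iff)
  moreover have "diag x ** diag y = mat 1 \<longleftrightarrow> (\<forall>i. x $ i * y $ i = 1)" for x y :: "complex^'a"
    by (simp add: vec_eq_iff diag_mult_entry(1)) (auto simp: diag_def mat_def split: if_splits)
  moreover have "z * cnj z = 1 \<longleftrightarrow> norm z = 1" for z
    by (metis complex_norm_square norm_ge_zero of_real_eq_1_iff power_one real_sqrt_abs abs_of_nonneg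
        real_sqrt_one)
  ultimately show ?thesis
    by (auto simp: unitary_group_def torus_def mult.commute)
qed

lemma mpow_diag: "mpow (diag x) n = diag (\<chi> i. x $ i ^ n)"
  unfolding mpow_def
  by (induction n) (auto simp: vec_eq_iff diag_mult_entry(1), auto simp: diag_def mat_def)

lemma eigvals_diag: "eigvals (diag x) = unordered x"
proof -
  have "charpoly (diag x) = (\<Prod>i\<in>UNIV. [:- (x $ i), 1:])"
    unfolding charpoly_def by (subst det_diagonal) (auto simp: diag_def)
  then have "x \<in> eigvals (diag x)" by (simp add: eigvals_def)
  then show ?thesis by (rule eigvals_eq_unordered)
qed

lemma eigvals_conj: "g \<in> unitary_group \<Longrightarrow> eigvals (g ** A ** adj g) = eigvals A"
  by (simp add: eigvals_def charpoly_conj)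

section \<open>Diagonalization of unitary matrices\<close>

text \<open>This is \<open>p(M) w\<close>, evaluated by Horner's scheme.\<close>
definition poly_vec :: "complex^'r^'r \<Rightarrow> complex^'r \<Rightarrow> complex poly \<Rightarrow> complex^'r" where
  "poly_vec M w p = fold_coeffs (\<lambda>a v. a *s w + M *v v) p 0"

lemma poly_vec_0 [simp]: "poly_vec M w 0 = 0"
  by (simp add: poly_vec_def)

lemma poly_vec_pCons [simp]: "poly_vec M w (pCons a p) = a *s w + M *v poly_vec M w p"
  by (cases "p = 0 \<and> a = 0") (auto simp: poly_vec_def)

lemma poly_vec_add: "poly_vec M w (p + q) = poly_vec M w p + poly_vec M w q"
  by (induction p q rule: poly_induct2) (simp_all add: algebra_simps vec.scale_left_distrib matrix_vector_right_distrib)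

lemma poly_vec_smult: "poly_vec M w (smult c p) = c *s poly_vec M w p"
  by (induction p) (simp_all add: vec.scale_right_distrib vec.scale)

lemma poly_vec_sum: "poly_vec M w (\<Sum>i\<in>I. f i) = (\<Sum>i\<in>I. poly_vec M w (f i))"
  by (induction I rule: infinite_finite_induct) (simp_all add: poly_vec_add)

lemma poly_vec_in_subspace:
  assumes "vec.subspace W" "\<And>v. v \<in> W \<Longrightarrow> M *v v \<in> W" "w \<in> W"
  shows "poly_vec M w p \<in> W"
  by (induction p) (simp_all add: assms vec.subspace_0 vec.subspace_add vec.subspace_scale)

text \<open>The vectors \<open>w, M w, M\<^sup>2 w, \<dots>, M\<^sup>r w\<close> are too many to be pairwise distinct and linearly independent.\<close>
lemma poly_vec_annihilator:
  fixes M :: "complex^'r^'r"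
  shows "\<exists>p. p \<noteq> 0 \<and> poly_vec M w p = 0"
proof (cases "inj (\<lambda>k::nat. poly_vec M w (monom 1 k))")
  case False
  then obtain i j :: nat where ij: "i \<noteq> j" "poly_vec M w (monom 1 i) = poly_vec M w (monom 1 j)"
    unfolding inj_def by blast
  have "poly_vec M w (monom 1 i + smult (-1) (monom 1 j)) = 0"
    by (simp only: poly_vec_add poly_vec_smult ij(2)) (simp add: vec_eq_iff)
  moreover have "coeff (monom 1 i + smult (-1) (monom 1 j)) i \<noteq> (0 :: complex)"
    using ij(1) by simp
  ultimately show ?thesis by (metis coeff_0)
next
  case True
  let ?f = "\<lambda>k::nat. poly_vec M w (monom 1 k)"
  let ?B = "?f ` {..CARD('r)}"
  have card: "card ?B = Suc CARD('r)"
    using True by (simp add: card_image inj_on_subset)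
  have "vec.dependent ?B"
  proof (rule ccontr)
    assume "vec.independent ?B"
    then have "card ?B \<le> vec.dim (UNIV :: (complex^'r) set)"
      by (intro vec.independent_card_le_dim) auto
    then show False using card by (simp add: card_cart_basis)
  qed
  then obtain u b where u: "(\<Sum>v\<in>?B. u v *s v) = 0" "b \<in> ?B" "u b \<noteq> 0"
    by (auto simp: vec.dependent_finite)
  let ?p = "\<Sum>k\<in>{..CARD('r)}. smult (u (?f k)) (monom 1 k)"
  have "poly_vec M w ?p = (\<Sum>v\<in>?B. u v *s v)"
    unfolding poly_vec_sum poly_vec_smult
    by (subst sum.reindex) (use True in \<open>auto simp: comp_def intro: inj_on_subset\<close>)
  moreover obtain k where k: "k \<le> CARD('r)" "b = ?f k" using u(2) by auto
  have "coeff ?p k = u b"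
    using k by (simp add: coeff_sum mult_delta_right)
  ultimately show ?thesis using u by (metis coeff_0)
qed

text \<open>Let \<open>p\<close> be of least degree among the nonzero polynomials with \<open>p(M) w = 0\<close>, and let \<open>z\<close> be a root of it, say
\<open>p = (X - z) q\<close>. Then \<open>q(M) w\<close> is nonzero by minimality, lies in \<open>W\<close>, and is an eigenvector for \<open>z\<close>.\<close>
lemma eigenvector_in_invariant_subspace:
  fixes M :: "complex^'r^'r"
  assumes W: "vec.subspace W" "\<And>v. v \<in> W \<Longrightarrow> M *v v \<in> W" and w: "w \<in> W" "w \<noteq> 0"
  shows "\<exists>v z. v \<in> W \<and> v \<noteq> 0 \<and> M *v v = z *s v"
proof -
  define P where "P d \<longleftrightarrow> (\<exists>p. p \<noteq> 0 \<and> poly_vec M w p = 0 \<and> degree p = d)" for d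
  have "\<exists>d. P d" using poly_vec_annihilator[of M w] by (auto simp: P_def)
  then have "P (LEAST d. P d)" by (rule LeastI_ex)
  then obtain p where p: "p \<noteq> 0" "poly_vec M w p = 0" "degree p = (LEAST d. P d)"
    using P_def by blast
  have "degree p \<noteq> 0"
  proof
    assume "degree p = 0"
    then obtain c where "p = [:c:]" by (metis degree_eq_zeroE)
    with p w show False by simp
  qed
  then have "\<not> constant (poly p)" by (simp add: constant_degree)
  then obtain z where "poly p z = 0" using fundamental_theorem_of_algebra by blast
  then obtain q where q: "p = [:- z, 1:] * q" by (metis dvdE poly_eq_0_iff_dvd)
  have q0: "q \<noteq> 0" using p(1) q by auto
  have "degree p = Suc (degree q)"
    unfolding q using q0 by (subst degree_mult_eq) auto
  then have "\<not> P (degree q)" using p(3) not_less_Least[of "degree q" P] by simp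
  with q0 have nz: "poly_vec M w q \<noteq> 0" by (auto simp: P_def)
  have "p = smult (- z) q + pCons 0 q" using q by simp
  then have "poly_vec M w p = (- z) *s poly_vec M w q + M *v poly_vec M w q"
    by (simp only: poly_vec_add poly_vec_smult poly_vec_pCons) simp
  then have "M *v poly_vec M w q = z *s poly_vec M w q"
    using p(2) by (simp add: vec_eq_iff add_eq_0_iff)
  with nz show ?thesis using poly_vec_in_subspace[OF W w(1)] by blast
qed

lemma norm_scalar_vec: "norm (c *s v) = cmod c * norm v"
  by (simp add: norm_vec_def norm_mult L2_set_right_distrib)

lemma matrix_axis_component: "(A *v axis j 1) $ i = A $ i $ j"
  by (simp add: matrix_vector_mult_def axis_def mult_delta_right)

text \<open>The Householder reflection in the hyperplane orthogonal to \<open>w = e\<^sub>a - v\<close> exchanges \<open>e\<^sub>a\<close> and \<open>v\<close>, because these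
have equal norm and a real inner product, and it fixes the \<open>e\<^sub>j\<close> with \<open>j \<in> S\<close>, because these are orthogonal to \<open>w\<close>.\<close>
lemma unitary_reflection:
  fixes v :: "complex^'r"
  assumes v: "norm v = 1" "Im (v $ a) = 0" and S: "a \<notin> S" "\<And>j. j \<in> S \<Longrightarrow> v $ j = 0"
  shows "\<exists>h \<in> unitary_group. h *v axis a 1 = v \<and> (\<forall>j\<in>S. h *v axis j 1 = axis j 1)"
proof (cases "v = axis a 1")
  case True
  then show ?thesis by (intro bexI[of _ "mat 1"]) auto
next
  case False
  define w where "w = axis a 1 - v"
  define N where "N = complex_of_real ((norm w)\<^sup>2)"
  define h :: "complex^'r^'r" where
    "h = (\<chi> i j. (if i = j then 1 else 0) - 2 * w $ i * cnj (w $ j) / N)"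
  have N0: "N \<noteq> 0" using False by (simp add: N_def w_def)
  have N_sum: "(\<Sum>j\<in>UNIV. cnj (w $ j) * w $ j) = N"
  proof -
    have "(norm w)\<^sup>2 = (\<Sum>j\<in>UNIV. (norm (w $ j))\<^sup>2)"
      by (simp add: norm_vec_def L2_set_def sum_nonneg)
    then show ?thesis
      unfolding N_def by (simp add: complex_norm_square mult.commute del: of_real_power)
  qed
  have "(norm w)\<^sup>2 = 2 - 2 * Re (v $ a)"
    unfolding w_def power2_norm_eq_inner
    using v(1) by (simp add: inner_diff_left inner_diff_right inner_axis inner_axis' norm_eq_1 inner_complex_def)
  moreover have "w $ a = complex_of_real (1 - Re (v $ a))"
    using v(2) by (simp add: w_def complex_eq_iff)
  \<comment> \<open>Hence the reflection subtracts \<open>w\<close> itself from \<open>e\<^sub>a\<close>, which leaves \<open>v\<close>.\<close>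
  ultimately have wa: "cnj (w $ a) = N / 2"
    by (simp add: N_def)
  have h_apply: "h *v x = x - (2 * (\<Sum>j\<in>UNIV. cnj (w $ j) * x $ j) / N) *s w" for x
  proof -
    have "(h *v x) $ i = x $ i - (2 * (\<Sum>j\<in>UNIV. cnj (w $ j) * x $ j) / N) * w $ i" for i
    proof -
      have "(h *v x) $ i = (\<Sum>j\<in>UNIV. (if i = j then x $ j else 0) - 2 * w $ i / N * (cnj (w $ j) * x $ j))"
        unfolding h_def matrix_vector_mult_def
        by (simp, intro sum.cong) (auto simp: field_simps)
      also have "\<dots> = x $ i - 2 * w $ i / N * (\<Sum>j\<in>UNIV. cnj (w $ j) * x $ j)"
        by (simp add: sum_subtractf sum_distrib_left)
      finally show ?thesis by (simp add: field_simps)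
    qed
    then show ?thesis by (simp add: vec_eq_iff)
  qed
  have inv: "h *v (h *v x) = x" for x
  proof -
    define c where "c = (\<Sum>j\<in>UNIV. cnj (w $ j) * x $ j)"
    have "(\<Sum>j\<in>UNIV. cnj (w $ j) * (x - (2 * c / N) *s w) $ j) =
        (\<Sum>j\<in>UNIV. cnj (w $ j) * x $ j - 2 * c / N * (cnj (w $ j) * w $ j))"
      by (intro sum.cong) (simp_all add: algebra_simps)
    also have "\<dots> = c - 2 * c / N * (\<Sum>j\<in>UNIV. cnj (w $ j) * w $ j)"
      by (simp only: sum_subtractf flip: sum_distrib_left c_def)
    also have "\<dots> = - c" using N0 by (simp add: N_sum)
    finally have "h *v (x - (2 * c / N) *s w) = x - (2 * c / N) *s w - (2 * (- c) / N) *s w"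
      by (simp only: h_apply)
    also have "\<dots> = x" by (simp add: vec_eq_iff)
    finally show ?thesis by (simp only: h_apply[of x] flip: c_def)
  qed
  have "h ** h = mat 1"
    by (subst matrix_eq) (simp add: inv flip: matrix_vector_mul_assoc)
  moreover have "adj h = h"
    by (simp add: adj_def h_def vec_eq_iff N_def)
  ultimately have "h \<in> unitary_group"
    by (simp add: unitary_group_def)
  moreover have "(\<Sum>j\<in>UNIV. cnj (w $ j) * axis k 1 $ j) = cnj (w $ k)" for k
    by (simp add: axis_def mult_delta_right)
  then have ax: "h *v axis k 1 = axis k 1 - (2 * cnj (w $ k) / N) *s w" for k
    by (simp add: h_apply)
  have "h *v axis a 1 = v"
    using N0 unfolding ax wa by (simp add: w_def)
  moreover have "h *v axis j 1 = axis j 1" if "j \<in> S" for j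
  proof -
    have "w $ j = 0" using that S by (auto simp: w_def axis_def)
    then show ?thesis by (simp add: ax)
  qed
  ultimately show ?thesis by blast
qed

text \<open>Suppose that the coordinate vectors of \<open>S\<close> are eigenvectors of \<open>M = g\<^sup>* A g\<close>. As \<open>M\<close> is unitary, the vectors
vanishing on \<open>S\<close> form an invariant subspace. It contains an eigenvector \<open>v\<close>, and a reflection that moves
\<open>e\<^sub>a\<close> to \<open>v\<close> and fixes the \<open>e\<^sub>j\<close> for \<open>j \<in> S\<close> extends the diagonalization to one more index \<open>a\<close>.\<close>
lemma partial_diagonalization:
  fixes A :: "complex^'r^'r"
  assumes A: "A \<in> unitary_group" and "finite S"
  shows "\<exists>g \<in> unitary_group. \<exists>x. \<forall>j\<in>S. (adj g ** A ** g) *v axis j 1 = x j *s axis j 1"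
  using \<open>finite S\<close>
proof induction
  case empty
  show ?case using unitary_one by blast
next
  case (insert a S)
  then obtain g x where g: "g \<in> unitary_group"
    and x: "\<And>j. j \<in> S \<Longrightarrow> (adj g ** A ** g) *v axis j 1 = x j *s axis j 1"
    by blast
  define M where "M = adj g ** A ** g"
  have M: "M \<in> unitary_group"
    using unitary_conj[OF unitary_adj[OF g] A] by (simp add: M_def)
  \<comment> \<open>Applying \<open>M\<^sup>*\<close> to \<open>M e\<^sub>j = x\<^sub>j e\<^sub>j\<close> shows that the rows of \<open>M\<close> with index in \<open>S\<close> vanish off the diagonal, too.\<close>
  have row: "M $ j $ k = 0" if "j \<in> S" "k \<noteq> j" for j k
  proof -
    have "axis j 1 = adj M *v (M *v axis j 1)"
      using M by (simp add: unitary_cancel)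
    also have "\<dots> = x j *s (adj M *v axis j 1)"
      using x[OF that(1)] by (simp add: M_def vec.scale)
    finally have eq: "axis j 1 $ i = x j * (adj M *v axis j 1) $ i" for i
      by (metis vector_smult_component)
    then have "axis j 1 $ i = x j * cnj (M $ j $ i)" for i
      unfolding matrix_axis_component by (simp add: adj_def)
    from this[of j] this[of k] that(2) show ?thesis
      by (auto simp: axis_def)
  qed
  define W where "W = {v :: complex^'r. \<forall>j\<in>S. v $ j = 0}"
  have "vec.subspace W"
    by (auto simp: W_def vec.subspace_def)
  moreover have "M *v v \<in> W" if "v \<in> W" for v
  proof -
    have "M $ j $ k * v $ k = 0" if "j \<in> S" for j k
      using row[OF that, of k] \<open>v \<in> W\<close> that by (cases "k = j") (auto simp: W_def)
    then show ?thesis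
      by (auto simp: W_def matrix_vector_mult_def simp del: mult_eq_0_iff intro!: sum.neutral)
  qed
  moreover have "axis a 1 \<in> W"
    using insert.hyps by (auto simp: W_def axis_def)
  moreover have "axis a 1 \<noteq> (0 :: complex^'r)"
    by (simp add: axis_eq_0_iff)
  ultimately obtain v z where v: "v \<in> W" "v \<noteq> 0" "M *v v = z *s v"
    using eigenvector_in_invariant_subspace by blast
  \<comment> \<open>The factor \<open>c\<close> normalizes \<open>v\<close> and makes its coordinate at \<open>a\<close> real, as the reflection requires.\<close>
  define c where "c = (if v $ a = 0 then 1 else cnj (v $ a) / cmod (v $ a)) / norm v"
  define v' where "v' = c *s v"
  have "cmod c = 1 / norm v"
    by (simp add: c_def norm_divide)
  then have "norm v' = 1"
    using v(2) by (simp add: v'_def norm_scalar_vec)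
  moreover have "Im (v' $ a) = 0"
  proof -
    have "c * v $ a = (if v $ a = 0 then 0 else complex_of_real (cmod (v $ a) / norm v))"
    proof -
      have "cnj (v $ a) * v $ a = complex_of_real (cmod (v $ a)) * cmod (v $ a)"
        using complex_norm_square[of "v $ a"] by (simp add: power2_eq_square mult.commute)
      then have "c * v $ a = complex_of_real (cmod (v $ a)) * cmod (v $ a) / cmod (v $ a) / norm v"
        if "v $ a \<noteq> 0" using that by (simp add: c_def)
      then show ?thesis by simp
    qed
    then show ?thesis by (simp add: v'_def)
  qed
  moreover have "v' $ j = 0" if "j \<in> S" for j
    using v(1) that by (simp add: v'_def W_def)
  ultimately obtain h where h: "h \<in> unitary_group" "h *v axis a 1 = v'"
      "\<And>j. j \<in> S \<Longrightarrow> h *v axis j 1 = axis j 1"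
    using unitary_reflection[of v' a S] insert.hyps by blast
  have conj: "(adj (g ** h) ** A ** (g ** h)) *v y = adj h *v (M *v (h *v y))" for y
    by (simp add: M_def adj_mult matrix_mul_assoc matrix_vector_mul_assoc)
  have undo: "adj h *v (c *s (h *v y)) = c *s y" for c y
    using h(1) by (simp add: vec.scale unitary_cancel)
  have "M *v v' = z *s v'"
    using v(3) by (simp add: v'_def vec.scale mult.commute)
  then have "(adj (g ** h) ** A ** (g ** h)) *v axis a 1 = z *s axis a 1"
    unfolding conj using undo[of z "axis a 1"] h(2) by simp
  moreover have "(adj (g ** h) ** A ** (g ** h)) *v axis j 1 = x j *s axis j 1" if "j \<in> S" for j
    unfolding conj using undo[of "x j" "axis j 1"] h(3)[OF that] x[OF that] by (simp add: M_def)
  ultimately have "\<forall>j\<in>insert a S. (adj (g ** h) ** A ** (g ** h)) *v axis j 1 = (x(a := z)) j *s axis j 1"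
    using insert.hyps by auto
  then show ?case
    using unitary_mult[OF g h(1)] by blast
qed

lemma unitary_diagonalization:
  fixes A :: "complex^'r^'r"
  assumes A: "A \<in> unitary_group"
  obtains g x where "g \<in> unitary_group" "x \<in> torus" "A = g ** diag x ** adj g"
proof -
  obtain g x where g: "g \<in> unitary_group"
    and x: "\<And>j. (adj g ** A ** g) *v axis j 1 = x j *s axis j 1"
    using partial_diagonalization[OF A, of UNIV] by auto
  let ?x = "\<chi> j. x j"
  have "(adj g ** A ** g) $ i $ j = diag ?x $ i $ j" for i j
    using x[of j] unfolding matrix_axis_component[symmetric]
    by (simp add: diag_mult_vec axis_def)
  then have D: "adj g ** A ** g = diag ?x"
    by (simp add: vec_eq_iff)
  then have "diag ?x \<in> unitary_group"
    using unitary_conj[OF unitary_adj[OF g] A] by simp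
  moreover have "A = g ** diag ?x ** adj g"
    using conj_inverse[OF unitary_adj[OF g], of A] D by simp
  ultimately show ?thesis
    using that g by (simp add: diag_unitary_iff)
qed

section \<open>Irreducible pairs and stabilizers\<close>

lemma matrix_inv_unitary:
  assumes "A \<in> unitary_group"
  shows "matrix_inv A = adj A"
proof -
  have "A ** matrix_inv A = mat 1 \<and> matrix_inv A ** A = mat 1"
    unfolding matrix_inv_def by (rule someI[of _ "adj A"]) (use assms in \<open>simp add: unitary_group_def\<close>)
  then have "adj A ** (A ** matrix_inv A) = adj A" by simp
  then show ?thesis using assms by (simp add: unitary_cancel)
qed

lemma commutator_unitary:
  assumes "A \<in> unitary_group" "B \<in> unitary_group"
  shows "commutator A B = mat 1 \<longleftrightarrow> A ** B = B ** A"
proof -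
  have "commutator A B = (A ** B) ** adj (B ** A)"
    using assms by (simp add: commutator_def matrix_inv_unitary adj_mult matrix_mul_assoc)
  moreover have "C ** adj D = mat 1 \<longleftrightarrow> C = D" if "D \<in> unitary_group" for C D :: "complex^'a^'a"
  proof
    assume "C ** adj D = mat 1"
    then have "C ** adj D ** D = D" by simp
    then show "C = D" using that by (simp only: unitary_cancel)
  qed (use that in \<open>simp add: unitary_cancel\<close>)
  ultimately show ?thesis using unitary_mult[OF assms(2,1)] by simp
qed

lemma mpow_unitary: "A \<in> unitary_group \<Longrightarrow> mpow A n \<in> unitary_group"
  by (induction n) (simp_all add: mpow_def unitary_mult)

lemma conj_mult:
  assumes "g \<in> unitary_group"
  shows "(g ** A ** adj g) ** (g ** B ** adj g) = g ** (A ** B) ** adj g"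
proof -
  have "(g ** A ** adj g) ** (g ** B ** adj g) = g ** A ** (adj g ** g) ** B ** adj g"
    by (simp only: matrix_mul_assoc)
  then show ?thesis using assms by (simp add: unitary_cancel matrix_mul_assoc)
qed

lemma mpow_conj:
  assumes "g \<in> unitary_group"
  shows "mpow (g ** A ** adj g) n = g ** mpow A n ** adj g"
proof (induction n)
  case 0
  show ?case using assms by (simp add: mpow_def unitary_cancel)
next
  case (Suc n)
  then show ?case using conj_mult[OF assms, of A] by (simp add: mpow_def)
qed

lemma irreducible_pair_conj:
  assumes g: "g \<in> unitary_group" and irr: "irreducible_pair A B"
  shows "irreducible_pair (g ** A ** adj g) (g ** B ** adj g)"
  unfolding irreducible_pair_def
proof (intro allI impI)
  fix W
  assume W: "vec.subspace W \<and> (\<forall>w\<in>W. (g ** A ** adj g) *v w \<in> W) \<and> (\<forall>w\<in>W. (g ** B ** adj g) *v w \<in> W)"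
  let ?W = "{v. g *v v \<in> W}"
  have "vec.subspace ?W"
    using W by (auto simp: vec.subspace_def vec.add vec.scale)
  moreover have "g *v (C *v v) = (g ** C ** adj g) *v (g *v v)" for C v
    using g by (simp add: unitary_cancel flip: matrix_vector_mul_assoc)
  then have "\<forall>v\<in>?W. A *v v \<in> ?W" "\<forall>v\<in>?W. B *v v \<in> ?W"
    using W by simp_all
  ultimately have triv: "?W = {0} \<or> ?W = UNIV"
    using irr by (simp add: irreducible_pair_def)
  have shift: "adj g *v w \<in> ?W \<longleftrightarrow> w \<in> W" for w
    using g by (simp add: unitary_cancel)
  moreover have "w = 0" if "adj g *v w = 0" for w
    using arg_cong[OF that, of "(*v) g"] g by (simp add: unitary_cancel)
  ultimately show "W = {0} \<or> W = UNIV"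
    using W triv shift vec.subspace_0[of W] by blast
qed

lemma irreps_conj:
  assumes g: "g \<in> unitary_group" and AB: "(A, B) \<in> irreps n"
  shows "(g ** A ** adj g, g ** B ** adj g) \<in> irreps n"
proof -
  from AB have U: "A \<in> unitary_group" "B \<in> unitary_group" "mpow A n \<in> unitary_group"
    by (auto simp: irreps_def mpow_unitary)
  moreover have "mpow A n ** B = B ** mpow A n"
    using AB U by (simp add: irreps_def commutator_unitary)
  ultimately show ?thesis
    using AB g
    by (simp add: irreps_def unitary_conj irreducible_pair_conj commutator_unitary mpow_conj conj_mult)
qed

text \<open>This is Schur's lemma for the relation \<open>[A\<^sup>n, B] = 1\<close>. The eigenspace of \<open>A\<^sup>n\<close> for the eigenvalue \<open>x\<^sub>k\<^sup>n\<close> is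
invariant under \<open>A\<close>, and under \<open>B\<close> because \<open>B\<close> commutes with \<open>A\<^sup>n\<close>. It contains \<open>e\<^sub>k\<close>, so it is everything.\<close>
lemma irreps_diag_iff:
  fixes x :: "complex^'r"
  shows "(diag x, B) \<in> irreps n \<longleftrightarrow> x \<in> torus \<and> B \<in> unitary_group \<and>
    (\<forall>i j. x $ i ^ n = x $ j ^ n) \<and> irreducible_pair (diag x) B"
proof -
  let ?y = "\<chi> i. x $ i ^ n"
  have comm: "commutator (mpow (diag x) n) B = mat 1 \<longleftrightarrow> (\<forall>i j. x $ i ^ n * B $ i $ j = B $ i $ j * x $ j ^ n)"
    if "x \<in> torus" "B \<in> unitary_group"
  proof -
    have "?y \<in> torus" using that(1) by (simp add: torus_def norm_power)
    then have "commutator (mpow (diag x) n) B = mat 1 \<longleftrightarrow> diag ?y ** B = B ** diag ?y"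
      using that(2) by (simp add: mpow_diag commutator_unitary diag_unitary_iff)
    then show ?thesis by (simp add: vec_eq_iff diag_mult_entry)
  qed
  have "x $ i ^ n = x $ k ^ n"
    if irr: "irreducible_pair (diag x) B" and
      c: "\<And>i j. x $ i ^ n * B $ i $ j = B $ i $ j * x $ j ^ n" for i k
  proof -
    define W where "W = {v :: complex^'r. \<forall>i. x $ i ^ n \<noteq> x $ k ^ n \<longrightarrow> v $ i = 0}"
    have "vec.subspace W"
      by (auto simp: W_def vec.subspace_def)
    moreover have "\<forall>w\<in>W. diag x *v w \<in> W"
      by (simp add: W_def diag_mult_vec)
    moreover have "B *v w \<in> W" if "w \<in> W" for w
    proof -
      have "B $ i $ j * w $ j = 0" if "x $ i ^ n \<noteq> x $ k ^ n" for i j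
        using c[of i j] that \<open>w \<in> W\<close> by (cases "x $ i ^ n = x $ j ^ n") (auto simp: W_def)
      then show ?thesis
        by (auto simp: W_def matrix_vector_mult_def simp del: mult_eq_0_iff intro!: sum.neutral)
    qed
    ultimately have "W = {0} \<or> W = UNIV"
      using irr unfolding irreducible_pair_def by blast
    moreover have "axis k 1 \<in> W" by (auto simp: W_def axis_def)
    moreover have "axis k 1 \<noteq> (0 :: complex^'r)" by (simp add: axis_eq_0_iff)
    ultimately have "W = UNIV" by (metis singletonD)
    then have "axis i 1 \<in> W" by simp
    then have "x $ i ^ n \<noteq> x $ k ^ n \<longrightarrow> axis i (1 :: complex) $ i = 0"
      unfolding W_def by blast
    then show ?thesis by (simp add: axis_def)
  qed
  then show ?thesis
    using comm by (auto simp: irreps_def diag_unitary_iff)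
qed

text \<open>The projection to an eigenspace is a polynomial in the matrix: up to a nonzero factor it is the
product of \<open>diag x - c\<close> over the other eigenvalues \<open>c\<close>.\<close>
lemma invariant_eigenspace_part:
  fixes x :: "complex^'r"
  assumes W: "vec.subspace W" "\<And>w. w \<in> W \<Longrightarrow> diag x *v w \<in> W" and w: "w \<in> W"
  shows "(\<chi> i. if x $ i = z then w $ i else 0) \<in> W"
proof -
  have prod: "(\<chi> i. (\<Prod>c\<in>S. x $ i - c) * w $ i) \<in> W" if "finite S" for S
    using that
  proof induction
    case empty
    then show ?case using w by simp
  next
    case (insert c S)
    let ?u = "\<chi> i. (\<Prod>c\<in>S. x $ i - c) * w $ i"
    have "diag x *v ?u - c *s ?u \<in> W"
      using insert.IH W by (simp add: vec.subspace_diff vec.subspace_scale)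
    moreover have "diag x *v ?u - c *s ?u = (\<chi> i. (\<Prod>c\<in>insert c S. x $ i - c) * w $ i)"
      using insert.hyps by (simp add: vec_eq_iff diag_mult_vec algebra_simps)
    ultimately show ?case by simp
  qed
  let ?S = "range (($) x) - {z}"
  define d where "d = (\<Prod>c\<in>?S. z - c)"
  have "d \<noteq> 0" by (auto simp: d_def)
  have "(\<Prod>c\<in>?S. x $ i - c) * w $ i = d * (if x $ i = z then w $ i else 0)" for i
    by (auto simp: d_def)
  then have "d *s (\<chi> i. if x $ i = z then w $ i else 0) \<in> W"
    using prod[of ?S] by (simp add: vector_scalar_mult_def)
  from vec.subspace_scale[OF W(1) this, of "inverse d"] \<open>d \<noteq> 0\<close> show ?thesis
    by simp
qed

text \<open>If equal entries of \<open>u\<close> give equal entries of \<open>v\<close>, then \<open>diag v\<close> is a linear combination of the projections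
to the eigenspaces of \<open>diag u\<close>, so it preserves every invariant subspace of \<open>diag u\<close>.\<close>
lemma irreducible_pair_diag_cong:
  fixes x y :: "complex^'r"
  assumes pattern: "\<And>i j. x $ i = x $ j \<longleftrightarrow> y $ i = y $ j"
  shows "irreducible_pair (diag x) B \<longleftrightarrow> irreducible_pair (diag y) B"
proof -
  have transfer: "diag v *v w \<in> W"
    if W: "vec.subspace W" "\<And>w. w \<in> W \<Longrightarrow> diag u *v w \<in> W" "w \<in> W"
      and uv: "\<And>i j. u $ i = u $ j \<Longrightarrow> v $ i = v $ j" for u v w :: "complex^'r" and W
  proof -
    let ?f = "\<lambda>z. v $ (SOME k. u $ k = z)"
    have f: "?f (u $ i) = v $ i" for i
      by (rule uv) (rule someI[of "\<lambda>k. u $ k = u $ i" i, OF refl])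
    have "(\<Sum>z\<in>range (($) u). ?f z *s (\<chi> i. if u $ i = z then w $ i else 0)) \<in> W"
      using W by (intro vec.subspace_sum vec.subspace_scale invariant_eigenspace_part) auto
    also have "(\<Sum>z\<in>range (($) u). ?f z *s (\<chi> i. if u $ i = z then w $ i else 0)) = diag v *v w"
      by (simp add: vec_eq_iff diag_mult_vec mult_delta_right f if_distrib sum.delta cong: if_cong)
    finally show ?thesis .
  qed
  show ?thesis
    unfolding irreducible_pair_def using transfer[of _ x _ y] transfer[of _ y _ x] pattern by blast
qed

text \<open>A matrix commutes with \<open>diag z\<close> if and only if it vanishes at all places \<open>(i, j)\<close> with \<open>z\<^sub>i \<noteq> z\<^sub>j\<close>.\<close>
lemma Stab_cong:
  fixes x y :: "complex^'r"
  assumes pattern: "\<And>i j. x $ i = x $ j \<longleftrightarrow> y $ i = y $ j"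
  shows "Stab x = Stab y"
proof -
  have comm: "g \<in> Stab z \<longleftrightarrow> g \<in> unitary_group \<and> (\<forall>i j. g $ i $ j = 0 \<or> z $ j = z $ i)"
    for g and z :: "complex^'r"
  proof -
    have "g ** diag z ** adj g = diag z \<longleftrightarrow> g ** diag z = diag z ** g" if "g \<in> unitary_group"
    proof
      assume "g ** diag z ** adj g = diag z"
      then have "g ** diag z ** adj g ** g = diag z ** g" by simp
      then show "g ** diag z = diag z ** g" using that by (simp only: unitary_cancel)
    qed (use that in \<open>simp add: unitary_cancel\<close>)
    moreover have "g ** diag z = diag z ** g \<longleftrightarrow> (\<forall>i j. g $ i $ j = 0 \<or> z $ j = z $ i)"
      by (auto simp: vec_eq_iff diag_mult_entry)
    ultimately show ?thesis by (auto simp: Stab_def)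
  qed
  show ?thesis
    unfolding set_eq_iff comm using pattern by simp
qed

section \<open>Unordered tuples and partitions\<close>

lemma unordered_eq_iff:
  fixes x y :: "complex^'a"
  shows "unordered x = unordered y \<longleftrightarrow> (\<exists>p\<in>{p. p permutes UNIV}. (\<chi> i. x $ p i) = y)"
proof -
  let ?a = "\<lambda>(p :: 'a \<Rightarrow> 'a) (x :: complex^'a). (\<chi> i. x $ p i) :: complex^'a"
  have "unordered z = {?a p z | p. p \<in> {p. p permutes UNIV}}" for z :: "complex^'a"
    by (simp add: unordered_def)
  moreover have "\<exists>e\<in>{p. p permutes UNIV}. \<forall>x. ?a e x = x"
    by (intro bexI[of _ id]) (auto simp: permutes_id)
  moreover have "\<exists>k\<in>{p. p permutes UNIV}. \<forall>x. ?a g (?a h x) = ?a k x"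
    if "g \<in> {p. p permutes UNIV}" "h \<in> {p. p permutes UNIV}" for g h :: "'a \<Rightarrow> 'a"
    using that by (intro bexI[of _ "h \<circ> g"]) (auto intro: permutes_compose)
  moreover have "\<exists>h\<in>{p. p permutes UNIV}. \<forall>x. ?a h (?a g x) = x"
    if "g \<in> {p. p permutes UNIV}" for g :: "'a \<Rightarrow> 'a"
    using that by (intro bexI[of _ "inv g"]) (auto simp: permutes_inv permutes_inverses)
  ultimately show ?thesis
    using orbit_eq_iff[of "{p. p permutes UNIV}" ?a x y] by simp
qed

lemma self_in_unordered: "x \<in> unordered x"
  unfolding unordered_def by (auto intro!: exI[of _ id] simp: permutes_id)

lemma unordered_eq_of_mem: "y \<in> unordered x \<Longrightarrow> unordered y = unordered x"
  using unordered_eq_iff[of x y] by (auto simp: unordered_def)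

lemma continuous_map_unordered: "continuous_map (top_of_set torus) sym_topology unordered"
  unfolding sym_topology_def by (intro quotient_imp_continuous_map quotient_map_quot_topology)

lemma open_map_unordered: "open_map (top_of_set torus) sym_topology unordered"
  unfolding sym_topology_def
proof (rule open_map_orbit_quotient[where G = "{p. p permutes UNIV}" and a = "\<lambda>p x. \<chi> i. x $ p i"])
  show "continuous_map (top_of_set torus) (top_of_set torus) (\<lambda>x. \<chi> i. x $ p i)" for p :: "'a \<Rightarrow> 'a"
    by (auto simp: torus_def intro!: continuous_intros)
qed (rule unordered_eq_iff)

text \<open>Values of \<open>f\<close> and \<open>g\<close> with the same multiplicity \<open>k\<close> are matched by a bijection \<open>h k\<close>. Together these give an
injective relabelling \<open>\<phi>\<close> of the values of \<open>f\<close> after which \<open>f\<close> and \<open>g\<close> take every value equally often, hence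
differ by a permutation of the index set.\<close>
lemma fiber_sizes_imp_permutation:
  fixes f :: "'i::finite \<Rightarrow> 'a" and g :: "'i \<Rightarrow> 'b"
  assumes sizes: "\<And>k. k > 0 \<Longrightarrow> card {z. card {i. f i = z} = k} = card {z. card {i. g i = z} = k}"
  obtains p where "p permutes UNIV" "\<And>i j. g (p i) = g (p j) \<longleftrightarrow> f i = f j"
proof -
  define F where "F k = {z. card {i. f i = z} = k}" for k
  define G where "G k = {z. card {i. g i = z} = k}" for k
  have range: "{z. card {i. c i = z} = k} \<subseteq> range c" if "k > 0" for k and c :: "'i \<Rightarrow> 'c"
  proof
    fix z assume "z \<in> {z. card {i. c i = z} = k}"
    then have "{i. c i = z} \<noteq> {}" using that by (auto simp: card_gt_0_iff)
    then show "z \<in> range c" by auto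
  qed
  have "finite (F k)" "finite (G k)" if "k > 0" for k
    unfolding F_def G_def by (rule finite_subset[OF range[OF that]]; simp)+
  then have "\<exists>h. bij_betw h (F k) (G k)" if "k > 0" for k
    using sizes[OF that] that unfolding F_def G_def by (intro finite_same_card_bij) auto
  then obtain h where h: "\<And>k. k > 0 \<Longrightarrow> bij_betw (h k) (F k) (G k)"
    by metis
  define \<phi> where "\<phi> z = h (card {i. f i = z}) z" for z
  have pos: "card {j. f j = f i} > 0" for i
    by (auto simp: card_gt_0_iff)
  have \<phi>: "card {j. g j = \<phi> (f i)} = card {j. f j = f i}" for i
  proof -
    have "f i \<in> F (card {j. f j = f i})" by (simp add: F_def)
    then have "\<phi> (f i) \<in> G (card {j. f j = f i})"
      using bij_betw_apply[OF h[OF pos]] by (simp add: \<phi>_def)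
    then show ?thesis by (simp add: G_def)
  qed
  have inj: "\<phi> (f i) = \<phi> (f j) \<longleftrightarrow> f i = f j" for i j
  proof
    assume eq: "\<phi> (f i) = \<phi> (f j)"
    let ?k = "card {m. f m = f i}"
    have k: "card {m. f m = f j} = ?k" using \<phi>[of i] \<phi>[of j] eq by simp
    then have "f i \<in> F ?k" "f j \<in> F ?k" by (simp_all add: F_def)
    moreover have "h ?k (f i) = h ?k (f j)" using eq k by (simp add: \<phi>_def)
    ultimately show "f i = f j"
      using h[OF pos[of i]] by (auto simp: bij_betw_def dest: inj_onD)
  qed simp
  have card_eq: "card {i. \<phi> (f i) = w} = card {i. g i = w}" for w
  proof (cases "\<exists>i. \<phi> (f i) = w")
    case True
    then obtain i where "w = \<phi> (f i)" by blast
    then show ?thesis using \<phi>[of i] by (simp add: inj)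
  next
    case False
    have "card {i. g i = w} = 0"
    proof (rule ccontr)
      assume "card {i. g i = w} \<noteq> 0"
      then have k: "card {i. g i = w} > 0" by (rule neq0_conv[THEN iffD1])
      have "w \<in> G (card {i. g i = w})" by (simp add: G_def)
      then have "w \<in> h (card {i. g i = w}) ` F (card {i. g i = w})"
        using bij_betw_imp_surj_on[OF h[OF k]] by simp
      then obtain z where z: "z \<in> F (card {i. g i = w})" "h (card {i. g i = w}) z = w"
        by (elim imageE) simp
      then obtain i where "z = f i" using range[OF k, of f] by (auto simp: F_def)
      then have "\<phi> (f i) = w" using z by (simp add: F_def \<phi>_def)
      with False show False by blast
    qed
    with False show ?thesis by simp
  qed
  have "image_mset (\<lambda>i. \<phi> (f i)) (mset_set UNIV) = image_mset g (mset_set UNIV)"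
    using card_eq by (intro multiset_eqI) (simp add: count_image_mset vimage_def)
  then obtain p where "p permutes UNIV" "\<And>i. \<phi> (f i) = g (p i)"
    using image_mset_eq_implies_permutes[of UNIV "\<lambda>i. \<phi> (f i)" g] by auto
  then show ?thesis using that inj by metis
qed

lemma bij_betw_position: "bij_betw (position :: 'r::{finite,wellorder} \<Rightarrow> nat) UNIV {..<CARD('r)}"
proof -
  have mono: "position i < position j" if "i < j" for i j :: 'r
    unfolding position_def using that by (intro psubset_card_mono) auto
  then have inj: "inj (position :: 'r \<Rightarrow> nat)"
    by (metis injI less_irrefl neqE)
  have "position i < CARD('r)" for i :: 'r
    unfolding position_def by (intro psubset_card_mono) auto
  then have "range (position :: 'r \<Rightarrow> nat) \<subseteq> {..<CARD('r)}" by auto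
  moreover have "card (range (position :: 'r \<Rightarrow> nat)) = card {..<CARD('r)}"
    using inj by (simp add: card_image)
  ultimately have "range (position :: 'r \<Rightarrow> nat) = {..<CARD('r)}"
    by (intro card_subset_eq) auto
  with inj show ?thesis by (simp add: bij_betw_def)
qed

lemma sum_list_take_mono: "b \<le> c \<Longrightarrow> sum_list (take b \<sigma>) \<le> sum_list (take c (\<sigma> :: nat list))"
  by (metis le_add1 le_add_diff_inverse sum_list_append take_add)

lemma block_less_length:
  assumes "p < sum_list \<sigma>"
  shows "block \<sigma> p < length \<sigma>"
proof -
  have "\<sigma> \<noteq> []" using assms by auto
  then have "p < sum_list (take (Suc (length \<sigma> - 1)) \<sigma>)" using assms by simp
  then have "block \<sigma> p \<le> length \<sigma> - 1" unfolding block_def by (rule Least_le)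
  then show ?thesis using \<open>\<sigma> \<noteq> []\<close> by (cases \<sigma>) auto
qed

lemma block_eq_iff:
  assumes "p < sum_list \<sigma>"
  shows "block \<sigma> p = b \<longleftrightarrow> sum_list (take b \<sigma>) \<le> p \<and> p < sum_list (take (Suc b) \<sigma>)"
proof
  have "p < sum_list (take (Suc (length \<sigma>)) \<sigma>)" using assms by simp
  then have "p < sum_list (take (Suc (block \<sigma> p)) \<sigma>)"
    unfolding block_def by (rule LeastI)
  moreover have "sum_list (take (block \<sigma> p) \<sigma>) \<le> p"
  proof (cases "block \<sigma> p")
    case (Suc c)
    then have "c < (LEAST b. p < sum_list (take (Suc b) \<sigma>))" by (simp add: block_def)
    from not_less_Least[OF this] Suc show ?thesis by simp
  qed simp
  ultimately show "sum_list (take b \<sigma>) \<le> p \<and> p < sum_list (take (Suc b) \<sigma>)" if "block \<sigma> p = b"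
    using that by simp
next
  assume b: "sum_list (take b \<sigma>) \<le> p \<and> p < sum_list (take (Suc b) \<sigma>)"
  show "block \<sigma> p = b"
    unfolding block_def
  proof (rule Least_equality)
    fix c assume c: "p < sum_list (take (Suc c) \<sigma>)"
    show "b \<le> c"
    proof (rule ccontr)
      assume "\<not> b \<le> c"
      then have "sum_list (take (Suc c) \<sigma>) \<le> sum_list (take b \<sigma>)"
        by (intro sum_list_take_mono) simp
      with b c show False by simp
    qed
  qed (use b in simp)
qed

lemma card_block:
  assumes "sum_list \<sigma> = CARD('r)" and b: "b < length \<sigma>"
  shows "card {i :: 'r::{finite,wellorder}. block \<sigma> (position i) = b} = \<sigma> ! b"
proof -
  have le: "sum_list (take (Suc b) \<sigma>) \<le> sum_list \<sigma>"
    using sum_list_take_mono[of "Suc b" "length \<sigma>" \<sigma>] b by simp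
  have "position ` {i :: 'r. block \<sigma> (position i) = b} = {p \<in> {..<CARD('r)}. block \<sigma> p = b}"
  proof -
    have "position ` {i :: 'r. block \<sigma> (position i) = b} = {p \<in> range (position :: 'r \<Rightarrow> nat). block \<sigma> p = b}"
      by blast
    then show ?thesis
      using bij_betw_imp_surj_on[OF bij_betw_position[where 'r = 'r]] by simp
  qed
  also have "\<dots> = {sum_list (take b \<sigma>)..<sum_list (take (Suc b) \<sigma>)}"
  proof (rule set_eqI)
    show "p \<in> {p \<in> {..<CARD('r)}. block \<sigma> p = b} \<longleftrightarrow>
        p \<in> {sum_list (take b \<sigma>)..<sum_list (take (Suc b) \<sigma>)}" for p
      using block_eq_iff[of p \<sigma> b] assms(1) le by (cases "p < CARD('r)") auto
  qed
  finally have "card (position ` {i :: 'r. block \<sigma> (position i) = b}) = \<sigma> ! b"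
    using b by (simp add: take_Suc_conv_app_nth)
  moreover have "inj_on position {i :: 'r. block \<sigma> (position i) = b}"
    using bij_betw_imp_inj_on[OF bij_betw_position[where 'r = 'r]] by (rule inj_on_subset) simp
  ultimately show ?thesis by (simp add: card_image)
qed

lemma block_ordered_fiber_sizes:
  fixes l :: "complex^'r::{finite,wellorder}"
  assumes part: "is_partition \<sigma> CARD('r)" and l: "block_ordered \<sigma> l" and k: "k > 0"
  shows "card {z. card {i. l $ i = z} = k} = count_list \<sigma> k"
proof -
  let ?block = "\<lambda>i :: 'r. block \<sigma> (position i)"
  have sum: "sum_list \<sigma> = CARD('r)" using part by (simp add: is_partition_def)
  have less: "?block i < length \<sigma>" for i
    using bij_betw_apply[OF bij_betw_position[where 'r = 'r], of i] sum by (intro block_less_length) simp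
  \<comment> \<open>The common value of \<open>l\<close> on block \<open>b\<close>; the blocks are nonempty because the parts are positive.\<close>
  define F where "F b = l $ (SOME i. ?block i = b)" for b
  have F_block: "F (?block i) = l $ i" for i
  proof -
    have "?block (SOME j. ?block j = ?block i) = ?block i" by (rule someI[of _ i]) simp
    then show ?thesis using l by (simp add: F_def block_ordered_def)
  qed
  have fiber: "{i. l $ i = F b} = {i. ?block i = b}" and ne: "{i. ?block i = b} \<noteq> {}" if b: "b < length \<sigma>" for b
  proof -
    have "\<sigma> ! b > 0" using part b by (simp add: is_partition_def)
    then show "{i. ?block i = b} \<noteq> {}" using card_block[OF sum b] by (metis card.empty less_irrefl)
    then obtain j where "?block j = b" by blast
    then have "F b = l $ j" using F_block by blast
    then show "{i. l $ i = F b} = {i. ?block i = b}"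
      using l \<open>?block j = b\<close> by (simp add: block_ordered_def)
  qed
  have "bij_betw F {b. b < length \<sigma> \<and> k = \<sigma> ! b} {z. card {i. l $ i = z} = k}"
    unfolding bij_betw_def
  proof
    show "inj_on F {b. b < length \<sigma> \<and> k = \<sigma> ! b}"
      using fiber ne by (intro inj_onI) (metis (mono_tags, lifting) Collect_empty_eq mem_Collect_eq)
    show "F ` {b. b < length \<sigma> \<and> k = \<sigma> ! b} = {z. card {i. l $ i = z} = k}"
    proof safe
      fix z assume k_eq: "k = card {i. l $ i = z}"
      then obtain i where i: "l $ i = z"
        using k by (metis (mono_tags, lifting) Collect_empty_eq card.empty less_irrefl)
      have "card {j. l $ j = z} = \<sigma> ! ?block i"
        using fiber[OF less[of i]] card_block[OF sum less[of i]] F_block[of i] i by simp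
      then show "z \<in> F ` {b. b < length \<sigma> \<and> card {i. l $ i = z} = \<sigma> ! b}"
        using less i F_block by (intro image_eqI[of _ _ "?block i"]) simp_all
    qed (simp add: fiber card_block[OF sum])
  qed
  then have "card {z. card {i. l $ i = z} = k} = card {b. b < length \<sigma> \<and> k = \<sigma> ! b}"
    by (simp add: bij_betw_same_card)
  then show ?thesis
    by (simp add: count_list_eq_length_filter length_filter_conv_card)
qed

text \<open>For parts \<open>k\<close> of the partition this is the definition of the type. The values with these multiplicities
already account for all \<open>r\<close> indices, as the parts add up to \<open>r\<close>, so no other multiplicities occur.\<close>
lemma has_type_fiber_sizes:
  fixes x :: "complex^'r"
  assumes part: "is_partition \<sigma> CARD('r)" and x: "has_type \<sigma> x" and k: "k > 0"
  shows "card {z. card {i. x $ i = z} = k} = count_list \<sigma> k"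
proof (cases "k \<in> set \<sigma>")
  case True
  then show ?thesis using x by (simp add: has_type_def)
next
  case False
  let ?c = "\<lambda>z. card {i. x $ i = z}"
  let ?R = "range (($) x)"
  have in_range: "z \<in> ?R" if "?c z > 0" for z
    using that by (metis (mono_tags, lifting) Collect_empty_eq card.empty less_irrefl rangeI)
  have "(\<Sum>z\<in>{z\<in>?R. ?c z \<in> set \<sigma>}. ?c z) = (\<Sum>m\<in>set \<sigma>. \<Sum>z\<in>{z\<in>{z\<in>?R. ?c z \<in> set \<sigma>}. ?c z = m}. ?c z)"
    by (intro sum.group[symmetric]) auto
  also have "\<dots> = (\<Sum>m\<in>set \<sigma>. m * count_list \<sigma> m)"
  proof (intro sum.cong refl)
    fix m assume m: "m \<in> set \<sigma>"
    then have "m > 0" using part by (simp add: is_partition_def)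
    then have "{z\<in>{z\<in>?R. ?c z \<in> set \<sigma>}. ?c z = m} = {z. ?c z = m}" using in_range m by auto
    then show "(\<Sum>z\<in>{z\<in>{z\<in>?R. ?c z \<in> set \<sigma>}. ?c z = m}. ?c z) = m * count_list \<sigma> m"
      using x m by (simp add: has_type_def)
  qed
  also have "\<dots> = sum_list \<sigma>"
    using sum_list_map_eq_sum_count[of id \<sigma>] by (simp add: mult.commute)
  also have "\<dots> = CARD('r)" using part by (simp add: is_partition_def)
  also have "\<dots> = (\<Sum>z\<in>?R. ?c z)"
    using sum.group[of "UNIV :: 'r set" ?R "($) x" "\<lambda>_. 1 :: nat"] by simp
  also have "\<dots> = sum ?c ({z\<in>?R. ?c z \<in> set \<sigma>} \<union> {z\<in>?R. ?c z \<notin> set \<sigma>})"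
    by (rule arg_cong[of _ _ "sum ?c"]) blast
  also have "\<dots> = (\<Sum>z\<in>{z\<in>?R. ?c z \<in> set \<sigma>}. ?c z) + (\<Sum>z\<in>{z\<in>?R. ?c z \<notin> set \<sigma>}. ?c z)"
    by (rule sum.union_disjoint) auto
  finally have zero: "(\<Sum>z\<in>{z\<in>?R. ?c z \<notin> set \<sigma>}. ?c z) = 0" by linarith
  have "finite {z\<in>?R. ?c z \<notin> set \<sigma>}" by (rule finite_subset[of _ ?R]) auto
  note all = iffD1[OF sum_eq_0_iff[OF this] zero]
  have rest: "?c z = 0" if "z \<in> ?R" "?c z \<notin> set \<sigma>" for z
    by (rule bspec[OF all]) (use that in simp)
  have "?c z \<noteq> k" for z
  proof
    assume eq: "?c z = k"
    have "z \<in> ?R" by (rule in_range) (simp only: eq k)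
    moreover have "?c z \<notin> set \<sigma>" unfolding eq by (rule False)
    ultimately have "?c z = 0" by (rule rest)
    with eq k show False by simp
  qed
  then have "{z. ?c z = k} = {}" by blast
  then show ?thesis using False by (simp add: count_list_0_iff)
qed

text \<open>Every tuple of type \<open>\<sigma>\<close> can be ordered with the same coincidences as \<open>l\<close>, as both have \<open>\<sigma>\<close> as their list of
multiplicities.\<close>
lemma block_ordered_rearrangement:
  fixes x l :: "complex^'r::{finite,wellorder}"
  assumes "is_partition \<sigma> CARD('r)" "has_type \<sigma> x" "block_ordered \<sigma> l"
  obtains p where "p permutes UNIV" "\<And>i j. x $ p i = x $ p j \<longleftrightarrow> l $ i = l $ j"
proof -
  have "card {z. card {i. l $ i = z} = k} = card {z. card {i. x $ i = z} = k}" if "k > 0" for k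
    using assms that by (simp add: block_ordered_fiber_sizes has_type_fiber_sizes)
  then show ?thesis
    using fiber_sizes_imp_permutation[of "($) l" "($) x"] that by blast
qed

lemma has_type_permute:
  assumes p: "p permutes UNIV"
  shows "has_type \<sigma> (\<chi> i. x $ p i) \<longleftrightarrow> has_type \<sigma> x"
proof -
  have "card {i. x $ p i = z} = card {i. x $ i = z}" for z
  proof -
    have "p ` {i. x $ p i = z} = {i. x $ i = z}"
      using surj_image_vimage_eq[OF permutes_surj[OF p], of "{i. x $ i = z}"] by (simp add: vimage_def)
    then show ?thesis
      using card_image[OF inj_on_subset[OF permutes_inj[OF p]], of "{i. x $ p i = z}"] by simp
  qed
  then show ?thesis by (simp add: has_type_def)
qed

lemma unordered_in_base_set_iff:
  assumes "x \<in> torus"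
  shows "unordered x \<in> base_set n \<sigma> \<longleftrightarrow> has_type \<sigma> x \<and> (\<forall>i j. x $ i ^ n = x $ j ^ n)"
proof -
  have "unordered x \<in> sym_sigma \<sigma> \<longleftrightarrow> has_type \<sigma> x"
  proof
    assume "unordered x \<in> sym_sigma \<sigma>"
    then obtain y where "has_type \<sigma> y" "unordered y = unordered x"
      unfolding sym_sigma_def by auto
    then show "has_type \<sigma> x" unfolding unordered_eq_iff using has_type_permute by auto
  qed (use assms in \<open>auto simp: sym_sigma_def\<close>)
  moreover have "(\<forall>l\<in>unordered x. \<forall>i j. l $ i ^ n = l $ j ^ n) \<longleftrightarrow> (\<forall>i j. x $ i ^ n = x $ j ^ n)"
    using self_in_unordered[of x] by (auto simp: unordered_def)
  ultimately show ?thesis by (simp add: base_set_def)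
qed

section \<open>Continuous ordering of eigenvalues over Zariski open sets\<close>

lemma topspace_zariski_torus: "topspace zariski_torus = torus"
proof
  show "topspace zariski_torus \<subseteq> torus"
    using openin_topspace[of zariski_torus] unfolding openin_zariski_torus by blast
  have "openin zariski_torus torus"
    unfolding openin_zariski_torus
    by (intro exI[of _ "{\<lambda>_. 1}"]) (auto intro: real_polynomial_function.intros(2))
  then show "torus \<subseteq> topspace zariski_torus" by (rule openin_subset)
qed

lemma real_polynomial_function_coordinate_power:
  "real_polynomial_function (\<lambda>x :: complex^'r. Re (x $ i ^ n))" (is ?Re)
  "real_polynomial_function (\<lambda>x :: complex^'r. Im (x $ i ^ n))" (is ?Im)
proof -
  have lin: "real_polynomial_function (\<lambda>x :: complex^'r. Re (x $ i))"
    "real_polynomial_function (\<lambda>x :: complex^'r. Im (x $ i))"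
    by (intro real_polynomial_function.intros(1) bounded_linear_compose[OF bounded_linear_Re]
        bounded_linear_compose[OF bounded_linear_Im] bounded_linear_vec_nth)+
  have "?Re \<and> ?Im"
    by (induction n)
      (auto intro!: real_polynomial_function.intros(2,3) real_polynomial_function_diff
        real_polynomial_function.intros(4)[OF lin(1)] real_polynomial_function.intros(4)[OF lin(2)])
  then show ?Re ?Im by auto
qed

text \<open>The complement is cut out by the real and imaginary parts of \<open>x\<^sub>i\<^sup>n - c\<close>, and it is invariant under permutations.\<close>
lemma openin_zariski_sym_power_neq:
  fixes c :: complex
  shows "openin zariski_sym (unordered ` {x :: complex^'r. x \<in> torus \<and> (\<exists>i. x $ i ^ n \<noteq> c)})"
proof -
  let ?T = "{x :: complex^'r. x \<in> torus \<and> (\<exists>i. x $ i ^ n \<noteq> c)}"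
  let ?P = "(\<Union>i. {\<lambda>x :: complex^'r. Re (x $ i ^ n) - Re c, \<lambda>x. Im (x $ i ^ n) - Im c})"
  have "?T = torus - {x \<in> torus. \<forall>p\<in>?P. p x = 0}"
    by (auto simp: complex_eq_iff)
  moreover have "\<forall>p\<in>?P. real_polynomial_function p"
    by (auto intro!: real_polynomial_function_diff real_polynomial_function_coordinate_power
        real_polynomial_function.intros(2))
  ultimately have "openin zariski_torus ?T"
    unfolding openin_zariski_torus by blast
  moreover have "{x \<in> torus. unordered x \<in> unordered ` ?T} = ?T"
  proof
    show "{x \<in> torus. unordered x \<in> unordered ` ?T} \<subseteq> ?T"
    proof safe
      fix x y :: "complex^'r" and i
      assume "unordered x = unordered y" "y $ i ^ n \<noteq> c"
      then show "\<exists>i. x $ i ^ n \<noteq> c" unfolding unordered_eq_iff by auto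
    qed
  qed auto
  ultimately show ?thesis
    by (auto simp: zariski_sym_def openin_quot_topology topspace_zariski_torus)
qed

text \<open>With \<open>d\<close> a coordinate of a representative of \<open>b\<close>, the set \<open>U\<close> consists of the base points whose common
\<open>n\<close>-th power is not \<open>-d\<^sup>n\<close>, the antipode of the value at \<open>b\<close>. There, the principal branch of the logarithm
gives a continuous \<open>n\<close>-th root \<open>\<mu>\<close> of the common power. The tuple \<open>\<zeta> = x / \<mu>\<close> varies in a finite set, on which
every choice \<open>\<rho>\<close> of an ordering is continuous, and \<open>t = \<mu> \<rho>(\<zeta>)\<close> is an ordering of \<open>x\<close> that depends only on
the unordered tuple.\<close>
lemma base_section:
  fixes l :: "complex^'r"
  assumes n: "n \<ge> 1"
    and rearrange: "\<And>x :: complex^'r. has_type \<sigma> x \<Longrightarrow>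
      \<exists>p. p permutes UNIV \<and> (\<forall>i j. x $ p i = x $ p j \<longleftrightarrow> l $ i = l $ j)"
    and b: "b \<in> base_set n \<sigma>"
  obtains U s where "openin (subtopology zariski_sym (base_set n \<sigma>)) U" "b \<in> U"
    "continuous_map (subtopology sym_topology U) (top_of_set torus) s"
    "\<And>u. u \<in> U \<Longrightarrow> s u \<in> u"
    "\<And>u i j. u \<in> U \<Longrightarrow> s u $ i = s u $ j \<longleftrightarrow> l $ i = l $ j"
proof -
  obtain x0 where x0: "x0 \<in> torus" "b = unordered x0"
    using b by (auto simp: base_set_def sym_sigma_def)
  \<comment> \<open>Any index will do, since the \<open>n\<close>-th powers of all coordinates agree on the base.\<close>
  define k where "k = (undefined :: 'r)"
  define d where "d = x0 $ k"
  have d: "norm d = 1" using x0(1) by (simp add: torus_def d_def)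
  then have d0: "d \<noteq> 0" by auto
  define T where "T = unordered ` {x :: complex^'r. x \<in> torus \<and> (\<exists>i. x $ i ^ n \<noteq> - (d ^ n))}"
  define U where "U = T \<inter> base_set n \<sigma>"
  have openU: "openin (subtopology zariski_sym (base_set n \<sigma>)) U"
    unfolding U_def T_def openin_subtopology using openin_zariski_sym_power_neq by blast
  define V where "V = {x :: complex^'r. x \<in> torus \<and> unordered x \<in> U}"
  have V_pow: "x $ i ^ n = x $ j ^ n" and V_neq: "x $ i ^ n \<noteq> - (d ^ n)" and V_type: "has_type \<sigma> x"
    if "x \<in> V" for x i j
  proof -
    have x: "x \<in> torus" "unordered x \<in> base_set n \<sigma>" "unordered x \<in> T"
      using that by (auto simp: V_def U_def)
    then show eq: "x $ i ^ n = x $ j ^ n" and "has_type \<sigma> x" for i j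
      using unordered_in_base_set_iff by blast+
    obtain y m where "y $ m ^ n \<noteq> - (d ^ n)" "unordered x = unordered y"
      using x(3) by (auto simp: T_def)
    then show "x $ i ^ n \<noteq> - (d ^ n)"
      using eq[of i] by (auto simp: unordered_eq_iff)
  qed
  have "x0 $ k ^ n \<noteq> - (d ^ n)"
    using d0 by (simp add: d_def eq_neg_iff_add_eq_0 flip: mult_2)
  then have bU: "b \<in> U"
    using b x0 by (auto simp: U_def T_def)

  define \<mu> where "\<mu> x = d * exp (Ln (x $ k ^ n / d ^ n) / of_nat n)" for x :: "complex^'r"
  have \<mu>0: "\<mu> x \<noteq> 0" for x using d0 by (simp add: \<mu>_def)
  have \<mu>_pow: "\<mu> x ^ n = x $ i ^ n" if "x \<in> V" for x i
  proof -
    have "x $ k \<noteq> 0" using that by (auto simp: V_def torus_def) (metis norm_zero zero_neq_one)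
    then have "\<mu> x ^ n = x $ k ^ n"
      using n d0 by (simp add: \<mu>_def power_mult_distrib flip: exp_of_nat_mult)
    then show ?thesis using V_pow[OF that] by metis
  qed
  have cont_\<mu>: "continuous_on V \<mu>"
  proof -
    \<comment> \<open>The quotient is on the unit circle, which meets the cut of the logarithm only at \<open>-1\<close>.\<close>
    have "x $ k ^ n / d ^ n \<notin> \<real>\<^sub>\<le>\<^sub>0" if "x \<in> V" for x
    proof
      assume "x $ k ^ n / d ^ n \<in> \<real>\<^sub>\<le>\<^sub>0"
      then obtain t where t: "x $ k ^ n / d ^ n = complex_of_real t" "t \<le> 0"
        by (auto elim!: nonpos_Reals_cases)
      have "norm (x $ k) = 1" using that by (simp add: V_def torus_def)
      then have "norm (x $ k ^ n / d ^ n) = 1" using d by (simp add: norm_divide norm_power)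
      then have "t = -1" using t by simp
      then have "x $ k ^ n = - (d ^ n)" using t(1) d0 by (simp add: field_simps)
      then show False using V_neq[OF that] by simp
    qed
    then show ?thesis
      unfolding \<mu>_def using d0 n by (intro continuous_intros) auto
  qed
  define \<zeta> where "\<zeta> x = (\<chi> i. x $ i / \<mu> x)" for x :: "complex^'r"
  have cont_\<zeta>: "continuous_on V \<zeta>"
    unfolding \<zeta>_def using cont_\<mu> \<mu>0 by (intro continuous_intros) auto
  define \<rho> where "\<rho> z = (SOME y. y \<in> unordered z \<and> (\<forall>i j. y $ i = y $ j \<longleftrightarrow> l $ i = l $ j))" for z :: "complex^'r"
  have \<rho>: "\<rho> (\<zeta> x) \<in> unordered (\<zeta> x)" "\<rho> (\<zeta> x) $ i = \<rho> (\<zeta> x) $ j \<longleftrightarrow> l $ i = l $ j"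
    if x: "x \<in> V" for x i j
  proof -
    obtain p where p: "p permutes UNIV" "\<And>i j. x $ p i = x $ p j \<longleftrightarrow> l $ i = l $ j"
      using rearrange[OF V_type[OF x]] by blast
    have "(\<chi> i. \<zeta> x $ p i) \<in> unordered (\<zeta> x)" using p(1) by (auto simp: unordered_def)
    moreover have "\<forall>i j. (\<chi> i. \<zeta> x $ p i) $ i = (\<chi> i. \<zeta> x $ p i) $ j \<longleftrightarrow> l $ i = l $ j"
      using p(2) \<mu>0 by (simp add: \<zeta>_def)
    ultimately have "\<rho> (\<zeta> x) \<in> unordered (\<zeta> x) \<and> (\<forall>i j. \<rho> (\<zeta> x) $ i = \<rho> (\<zeta> x) $ j \<longleftrightarrow> l $ i = l $ j)"
      unfolding \<rho>_def by (intro someI) blast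
    then show "\<rho> (\<zeta> x) \<in> unordered (\<zeta> x)" "\<rho> (\<zeta> x) $ i = \<rho> (\<zeta> x) $ j \<longleftrightarrow> l $ i = l $ j"
      by blast+
  qed
  define t where "t x = (\<chi> i. \<mu> x * \<rho> (\<zeta> x) $ i)" for x :: "complex^'r"
  have t_mem: "t x \<in> unordered x" if x: "x \<in> V" for x
  proof -
    obtain p where p: "p permutes UNIV" "\<rho> (\<zeta> x) = (\<chi> i. \<zeta> x $ p i)"
      using \<rho>(1)[OF x] by (auto simp: unordered_def)
    then have "t x = (\<chi> i. x $ p i)" using \<mu>0 by (simp add: t_def \<zeta>_def)
    then show ?thesis using p(1) by (auto simp: unordered_def)
  qed
  have t_inv: "t y = t x" if x: "x \<in> V" and y: "unordered y = unordered x" for x y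
  proof -
    obtain p where p: "p permutes UNIV" "y = (\<chi> i. x $ p i)"
      using y[symmetric] unfolding unordered_eq_iff by auto
    have \<mu>: "\<mu> y = \<mu> x" using p(2) V_pow[OF x, of "p k" k] by (simp add: \<mu>_def)
    then have "\<zeta> y = (\<chi> i. \<zeta> x $ p i)" using p(2) by (simp add: \<zeta>_def)
    then have "unordered (\<zeta> y) = unordered (\<zeta> x)"
      using p(1) unordered_eq_iff[of "\<zeta> x" "\<zeta> y"] by auto
    then show ?thesis using \<mu> by (simp add: t_def \<rho>_def)
  qed
  have cont_t: "continuous_on V t"
  proof -
    have "finite {z :: complex. z ^ n = 1}" using n by (intro finite_nth_roots) simp
    then have "finite {z :: complex^'r. \<forall>i. z $ i \<in> {z. z ^ n = 1}}"
      by (intro finite_subset[OF _ finite_imageI[OF finite_PiE[of UNIV "\<lambda>_. {z. z ^ n = 1}"], of vec_lambda]])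
        (auto simp: image_iff PiE_def intro!: bexI[of _ "vec_nth _"])
    moreover have "\<zeta> ` V \<subseteq> {z. \<forall>i. z $ i \<in> {z. z ^ n = 1}}"
      using \<mu>0 \<mu>_pow by (auto simp: \<zeta>_def power_divide)
    ultimately have "finite (\<zeta> ` V)" by (rule finite_subset[rotated])
    then have "continuous_on (\<zeta> ` V) \<rho>" by (rule continuous_on_finite)
    then have "continuous_on V (\<lambda>x. \<rho> (\<zeta> x))"
      using cont_\<zeta> by (rule continuous_on_compose2) simp
    then show ?thesis
      unfolding t_def using cont_\<mu> by (intro continuous_intros)
  qed
  define s where "s u = t (SOME x. x \<in> u)" for u
  have s_unordered: "s (unordered x) = t x" if "x \<in> V" for x
  proof -
    have "(SOME y. y \<in> unordered x) \<in> unordered x" using self_in_unordered by (rule someI)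
    from t_inv[OF that unordered_eq_of_mem[OF this]] show ?thesis by (simp add: s_def)
  qed
  have U_V: "\<exists>x\<in>V. u = unordered x" if "u \<in> U" for u
    using that by (auto simp: U_def T_def V_def)
  have torus_permute: "y \<in> torus" if "y \<in> unordered x" "x \<in> torus" for x y :: "complex^'r"
    using that by (auto simp: unordered_def torus_def)
  have "quotient_map (subtopology (top_of_set torus) V) (subtopology sym_topology U) unordered"
    using open_map_unordered unfolding sym_topology_def
    by (rule quotient_map_restrict_open) (auto simp: V_def)
  moreover have "subtopology (top_of_set torus) V = top_of_set V"
    by (simp add: subtopology_subtopology V_def Int_absorb1 subset_iff)
  moreover have "continuous_map (top_of_set V) (top_of_set torus) (s \<circ> unordered)"
  proof (rule continuous_map_eq)
    show "continuous_map (top_of_set V) (top_of_set torus) t"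
      using cont_t t_mem torus_permute by (auto simp: continuous_map_in_subtopology V_def)
  qed (simp add: s_unordered)
  ultimately have "continuous_map (subtopology sym_topology U) (top_of_set torus) s"
    by (metis continuous_compose_quotient_map)
  moreover have "s u \<in> u" if "u \<in> U" for u
    using U_V[OF that] s_unordered t_mem by metis
  moreover have "s u $ i = s u $ j \<longleftrightarrow> l $ i = l $ j" if u: "u \<in> U" for u i j
  proof -
    obtain x where x: "x \<in> V" "u = unordered x" using U_V[OF u] by blast
    show ?thesis using \<rho>(2)[OF x(1)] \<mu>0 by (simp add: x(2) s_unordered[OF x(1)] t_def)
  qed
  ultimately show ?thesis using that openU bU by blast
qed

section \<open>Conjugacy classes and eigenvalues\<close>

definition pair_conj :: "complex^'r^'r \<Rightarrow> (complex^'r^'r) \<times> (complex^'r^'r) \<Rightarrow> (complex^'r^'r) \<times> (complex^'r^'r)" where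
  "pair_conj g = (\<lambda>(A, B). (g ** A ** adj g, g ** B ** adj g))"

lemma pair_conj_apply [simp]: "pair_conj g (A, B) = (g ** A ** adj g, g ** B ** adj g)"
  by (simp add: pair_conj_def)

lemma conj_class_eq_orbit: "conj_class P = {pair_conj g P | g. g \<in> unitary_group}"
  by (cases P) (simp add: conj_class_def)

lemma conj_class_eq_iff: "conj_class P = conj_class Q \<longleftrightarrow> (\<exists>g\<in>unitary_group. pair_conj g P = Q)"
  unfolding conj_class_eq_orbit
proof (rule orbit_eq_iff)
  show "\<exists>e\<in>unitary_group. \<forall>P. pair_conj e P = (P :: (complex^'a^'a) \<times> (complex^'a^'a))"
    by (rule bexI[of _ "mat 1"]) auto
  show "\<exists>k\<in>unitary_group. \<forall>P. pair_conj g (pair_conj h P) = pair_conj k P"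
    if "g \<in> unitary_group" "h \<in> unitary_group" for g h :: "complex^'a^'a"
    using that by (intro bexI[of _ "g ** h"]) (auto simp: conj_conj unitary_mult)
  show "\<exists>h\<in>unitary_group. \<forall>P. pair_conj h (pair_conj g P) = P"
    if "g \<in> unitary_group" for g :: "complex^'a^'a"
    using that by (intro bexI[of _ "adj g"]) (auto simp: conj_inverse unitary_adj)
qed

lemma Stab_mult: "\<lbrakk>g \<in> Stab l; h \<in> Stab l\<rbrakk> \<Longrightarrow> g ** h \<in> Stab l"
  by (simp add: Stab_def unitary_mult flip: conj_conj)

lemma Stab_adj: "g \<in> Stab l \<Longrightarrow> adj g \<in> Stab l"
  using conj_inverse[of g "diag l"] by (simp add: Stab_def unitary_adj)

lemma stab_class_eq_iff: "stab_class l B = stab_class l C \<longleftrightarrow> (\<exists>g\<in>Stab l. g ** B ** adj g = C)"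
  unfolding stab_class_def
proof (rule orbit_eq_iff)
  show "\<exists>e\<in>Stab l. \<forall>B. e ** B ** adj e = B"
    by (rule bexI[of _ "mat 1"]) (auto simp: Stab_def)
  show "\<exists>k\<in>Stab l. \<forall>B. g ** (h ** B ** adj h) ** adj g = k ** B ** adj k"
    if "g \<in> Stab l" "h \<in> Stab l" for g h
    using that by (intro bexI[of _ "g ** h"]) (auto simp: conj_conj Stab_mult)
  show "\<exists>h\<in>Stab l. \<forall>B. h ** (g ** B ** adj g) ** adj h = B" if "g \<in> Stab l" for g
  proof (rule bexI[OF _ Stab_adj[OF that]])
    show "\<forall>B. adj g ** (g ** B ** adj g) ** adj (adj g) = B"
      using that by (simp add: Stab_def conj_inverse)
  qed
qed

lemma open_map_conj_class: "open_map (top_of_set (irreps n)) (X_star n) conj_class"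
  unfolding X_star_def
proof (rule open_map_orbit_quotient[where G = unitary_group and a = pair_conj])
  show "continuous_map (top_of_set (irreps n)) (top_of_set (irreps n)) (pair_conj g)"
    if "g \<in> unitary_group" for g :: "complex^'a^'a"
    using irreps_conj[OF that]
    by (auto simp: pair_conj_def case_prod_beta intro!: continuous_intros)
qed (rule conj_class_eq_iff)

lemma open_map_stab_class:
  "open_map (top_of_set unitary_group) (quot_topology (top_of_set unitary_group) (stab_class l)) (stab_class l)"
proof (rule open_map_orbit_quotient[where G = "Stab l" and a = "\<lambda>g B. g ** B ** adj g"])
  show "continuous_map (top_of_set unitary_group) (top_of_set unitary_group) (\<lambda>B. g ** B ** adj g)"
    if "g \<in> Stab l" for g
    using that by (auto simp: Stab_def unitary_conj intro!: continuous_intros)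
qed (rule stab_class_eq_iff)

text \<open>Irreducibility together with \<open>diag l\<close> is invariant under the stabilizer, so \<open>I\<close> is saturated.\<close>
lemma F_fiber_quotient:
  fixes l :: "complex^'r"
  defines "I \<equiv> {B \<in> unitary_group. irreducible_pair (diag l) B}"
  shows "open_map (top_of_set I) (F_fiber l) (stab_class l)"
    and "quotient_map (top_of_set I) (F_fiber l) (stab_class l)"
proof -
  have "{B \<in> topspace (top_of_set unitary_group). stab_class l B \<in> stab_class l ` I} = I"
  proof
    show "{B \<in> topspace (top_of_set unitary_group). stab_class l B \<in> stab_class l ` I} \<subseteq> I"
    proof clarify
      fix B C assume B: "B \<in> topspace (top_of_set unitary_group)" and C: "C \<in> I"
        and "stab_class l B = stab_class l C"
      then obtain g where g: "g \<in> Stab l" "g ** C ** adj g = B"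
        using stab_class_eq_iff by metis
      have "irreducible_pair (g ** diag l ** adj g) (g ** C ** adj g)"
        using g C by (intro irreducible_pair_conj) (auto simp: Stab_def I_def)
      then show "B \<in> I" using g B by (simp add: Stab_def I_def)
    qed
  qed (auto simp: I_def)
  note restrict = quotient_map_restrict_open[OF open_map_stab_class this]
  have "subtopology (top_of_set unitary_group) I = top_of_set I"
    by (simp add: subtopology_subtopology I_def Int_absorb1 subset_iff)
  then show "open_map (top_of_set I) (F_fiber l) (stab_class l)"
    "quotient_map (top_of_set I) (F_fiber l) (stab_class l)"
    using restrict unfolding F_fiber_def I_def by simp_all
qed

lemma conj_class_quotient:
  fixes T :: "(complex^'r) set set" and n :: nat
  defines "R \<equiv> {(A, B). (A, B) \<in> irreps n \<and> eigvals A \<in> T}"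
  shows "quotient_map (top_of_set R) (subtopology (X_star n) (conj_class ` R)) conj_class"
proof -
  have "{P \<in> topspace (top_of_set (irreps n)). conj_class P \<in> conj_class ` R} = R"
  proof
    show "{P \<in> topspace (top_of_set (irreps n)). conj_class P \<in> conj_class ` R} \<subseteq> R"
    proof clarify
      fix A B A' B' assume "(A, B) \<in> topspace (top_of_set (irreps n))"
        "conj_class (A, B) = conj_class (A', B')" "(A', B') \<in> R"
      then show "(A, B) \<in> R"
        using omega_conj_class[of A B] omega_conj_class[of A' B'] by (simp add: R_def)
    qed
  qed (auto simp: R_def)
  note quotient_map_restrict_open(2)[OF open_map_conj_class[unfolded X_star_def] this]
  moreover have "subtopology (top_of_set (irreps n)) R = top_of_set R"
    by (auto simp: subtopology_subtopology R_def intro!: arg_cong[of _ _ top_of_set])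
  ultimately show ?thesis by (simp add: X_star_def)
qed

lemma irreps_diagonal_form:
  fixes A B :: "complex^'r^'r"
  assumes AB: "(A, B) \<in> irreps n"
  obtains g x C where "g \<in> unitary_group" "(diag x, C) \<in> irreps n" "(A, B) = pair_conj g (diag x, C)"
proof -
  have "A \<in> unitary_group" using AB by (simp add: irreps_def)
  then obtain g x where g: "g \<in> unitary_group" "A = g ** diag x ** adj g"
    using unitary_diagonalization by blast
  define C where "C = adj g ** B ** g"
  have "B = g ** C ** adj g" "adj g ** A ** g = diag x"
    using conj_inverse[OF unitary_adj[OF g(1)], of B] conj_inverse[OF g(1), of "diag x"] g(2)
    by (simp_all add: C_def)
  moreover have "(adj g ** A ** g, C) \<in> irreps n"
    using irreps_conj[OF unitary_adj[OF g(1)] AB] by (simp add: C_def)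
  ultimately show ?thesis using that g by simp
qed

text \<open>Reordering the diagonal entries is a conjugation by a permutation matrix.\<close>
lemma diag_permute_conj:
  fixes x :: "complex^'r"
  assumes p: "p permutes UNIV"
  obtains P where "P \<in> unitary_group" "diag x = P ** diag (\<chi> i. x $ p i) ** adj P"
proof -
  define P :: "complex^'r^'r" where "P = (\<chi> i j. if i = p j then 1 else 0)"
  have inj: "p i = p j \<longleftrightarrow> i = j" for i j
    using permutes_inj[OF p] by (auto dest: injD)
  have "adj P ** P = mat 1"
    by (simp add: vec_eq_iff matrix_matrix_mult_def adj_def P_def mat_def inj if_distrib[of cnj]
        mult_delta_left cong: if_cong)
  then have P: "P \<in> unitary_group"
    using matrix_left_right_inverse[of P "adj P"] by (simp add: unitary_group_def)
  have "diag x ** P = P ** diag (\<chi> i. x $ p i)"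
    by (simp add: vec_eq_iff diag_mult_entry P_def)
  then have "diag x ** P ** adj P = P ** diag (\<chi> i. x $ p i) ** adj P" by simp
  then show ?thesis using that P by (simp add: unitary_cancel)
qed

lemma irreps_eigvals_in_base_set:
  assumes "(A, B) \<in> irreps n" "eigvals A \<in> sym_sigma \<sigma>"
  shows "eigvals A \<in> base_set n \<sigma>"
proof -
  obtain g x C where g: "g \<in> unitary_group" "(diag x, C) \<in> irreps n" "(A, B) = pair_conj g (diag x, C)"
    using irreps_diagonal_form[OF assms(1)] by blast
  have "eigvals A = unordered x" using g by (simp add: eigvals_conj eigvals_diag)
  moreover have "\<forall>i j. x $ i ^ n = x $ j ^ n" using g(2) by (simp add: irreps_diag_iff)
  ultimately show ?thesis using assms(2) by (auto simp: base_set_def unordered_def)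
qed

text \<open>The parametrization of pairs of unitary matrices by a diagonalization of the first matrix.\<close>
definition diag_conj :: "(complex^'r^'r) \<times> (complex^'r) \<times> (complex^'r^'r) \<Rightarrow> (complex^'r^'r) \<times> (complex^'r^'r)" where
  "diag_conj = (\<lambda>(g, x, B). pair_conj g (diag x, B))"

lemma continuous_on_diag_conj: "continuous_on S diag_conj"
  unfolding diag_conj_def pair_conj_def case_prod_beta prod.sel
  by (intro continuous_intros)

lemma continuous_map_diag_conj:
  "continuous_map (top_of_set (unitary_group \<times> torus \<times> unitary_group))
     (top_of_set (unitary_group \<times> (unitary_group :: (complex^'r^'r) set))) diag_conj"
  by (simp add: continuous_on_diag_conj) (auto simp: diag_conj_def unitary_conj diag_unitary_iff)

lemma closed_map_diag_conj:
  "closed_map (top_of_set (unitary_group \<times> torus \<times> unitary_group))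
     (top_of_set (unitary_group \<times> (unitary_group :: (complex^'r^'r) set))) diag_conj"
proof (rule T1_Spaces.continuous_imp_closed_map[OF continuous_map_diag_conj])
  show "compact_space (top_of_set (unitary_group \<times> torus \<times> (unitary_group :: (complex^'r^'r) set)))"
    by (simp add: compact_space_subtopology compact_Times compact_unitary_group compact_torus)
qed (simp add: Hausdorff_space_subtopology)

lemma diag_conj_surj:
  fixes A B :: "complex^'r^'r"
  assumes "A \<in> unitary_group" "B \<in> unitary_group"
  shows "(A, B) \<in> diag_conj ` (unitary_group \<times> torus \<times> unitary_group)"
proof -
  obtain g x where g: "g \<in> unitary_group" "x \<in> torus" "A = g ** diag x ** adj g"
    using unitary_diagonalization[OF assms(1)] by blast
  moreover have "adj g ** B ** g \<in> unitary_group"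
    using unitary_conj[OF unitary_adj[OF g(1)] assms(2)] by simp
  moreover have "(A, B) = diag_conj (g, x, adj g ** B ** g)"
    using g conj_inverse[OF unitary_adj[OF g(1)], of B] by (simp add: diag_conj_def)
  ultimately show ?thesis by blast
qed

text \<open>Pulled back along the closed surjection \<^const>\<open>diag_conj\<close>, the unordered eigenvalues are a continuous function
of the coordinate \<open>x\<close>.\<close>
lemma continuous_map_eigvals:
  "continuous_map (top_of_set (unitary_group \<times> unitary_group)) sym_topology
     (\<lambda>P :: (complex^'r^'r) \<times> (complex^'r^'r). eigvals (fst P))"
proof (rule continuous_compose_quotient_map)
  let ?D = "unitary_group \<times> torus \<times> (unitary_group :: (complex^'r^'r) set)"
  show "quotient_map (top_of_set ?D) (top_of_set (unitary_group \<times> unitary_group)) diag_conj"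
  proof (rule continuous_closed_imp_quotient_map[OF continuous_map_diag_conj closed_map_diag_conj])
    show "diag_conj ` topspace (top_of_set ?D) = topspace (top_of_set (unitary_group \<times> unitary_group))"
      using diag_conj_surj by (auto simp: diag_conj_def unitary_conj diag_unitary_iff)
  qed
  have "continuous_map (top_of_set ?D) (top_of_set torus) (\<lambda>w. fst (snd w))"
    by (auto intro!: continuous_intros)
  then have "continuous_map (top_of_set ?D) sym_topology (unordered \<circ> (\<lambda>w. fst (snd w)))"
    using continuous_map_unordered by (rule continuous_map_compose)
  then show "continuous_map (top_of_set ?D) sym_topology ((\<lambda>P. eigvals (fst P)) \<circ> diag_conj)"
    by (rule continuous_map_eq) (auto simp: diag_conj_def eigvals_conj eigvals_diag)
qed

text \<open>Two elements of a class with the same first matrix \<open>diag x\<close> differ by an element of its stabilizer.\<close>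
lemma conj_class_slice:
  assumes pattern: "\<And>i j. x $ i = x $ j \<longleftrightarrow> l $ i = l $ j"
  shows "{C. (diag x, C) \<in> conj_class (diag x, B)} = stab_class l B"
proof -
  have "{C. (diag x, C) \<in> conj_class (diag x, B)} = stab_class x B"
    by (auto simp: conj_class_def stab_class_def Stab_def; metis)
  then show ?thesis using Stab_cong[OF pattern] by (simp add: stab_class_def)
qed

section \<open>Local triviality of the eigenvalue map\<close>

text \<open>The trivialization sends a class \<open>c\<close> over \<open>u\<close> to the set of all \<open>C\<close> with \<open>(diag (s u), C) \<in> c\<close>, which is a single
orbit of the stabilizer. It is continuous because this holds after pulling back to the set \<open>D2\<close> of
diagonalizations whose diagonal is ordered according to \<open>s\<close>: this set is closed in \<open>D1\<close>, hence still maps onto the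
pairs over \<open>U\<close> by a quotient map, and on it the trivialization is \<open>(g, x, B) \<mapsto> (unordered x, stab_class l B)\<close>.
Its inverse is induced by \<open>j (u, B)\<close>, the class of \<open>(diag (s u), B)\<close>: the composition \<open>h \<circ> j\<close> is the product of
the identity with the quotient map to the fiber, hence a quotient map, and therefore so is \<open>h\<close>.\<close>
lemma omega_trivial_over_section:
  fixes l :: "complex^'r"
  assumes U: "U \<subseteq> base_set n \<sigma>"
    and s: "continuous_map (subtopology sym_topology U) (top_of_set torus) s"
    and s_mem: "\<And>u. u \<in> U \<Longrightarrow> s u \<in> u"
    and pattern: "\<And>u i j. u \<in> U \<Longrightarrow> s u $ i = s u $ j \<longleftrightarrow> l $ i = l $ j"
  defines "E \<equiv> X_sigma n \<sigma>"
  shows "\<exists>h. homeomorphic_map (subtopology E {c \<in> topspace E. omega c \<in> U})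
      (prod_topology (subtopology sym_topology U) (F_fiber l)) h \<and>
    (\<forall>c\<in>topspace E. omega c \<in> U \<longrightarrow> fst (h c) = omega c)"
proof -
  define R where "R = {(A, B). (A, B) \<in> irreps n \<and> eigvals A \<in> U}"
  define I where "I = {B \<in> unitary_group. irreducible_pair (diag l) B}"
  define EU where "EU = subtopology (X_star n) (conj_class ` R)"
  define h where "h c = (omega c, {C. (diag (s (omega c)), C) \<in> c})" for c
  have topspace_sym: "topspace sym_topology = unordered ` torus"
    by (simp add: sym_topology_def topspace_quot_topology)
  have U_torus: "U \<subseteq> unordered ` torus"
    using U by (auto simp: base_set_def sym_sigma_def)
  have s_torus: "s u \<in> torus" and s_unordered: "unordered (s u) = u" if u: "u \<in> U" for u
  proof -
    show "s u \<in> torus"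
      using continuous_map_image_subset_topspace[OF s] u U_torus
      by (simp add: topspace_sym image_subset_iff) blast
    obtain x where "u = unordered x" using u U_torus by blast
    then show "unordered (s u) = u" using s_mem[OF u] unordered_eq_of_mem by blast
  qed
  have EU: "subtopology E {c \<in> topspace E. omega c \<in> U} = EU"
  proof -
    let ?S = "{conj_class (A, B) | A B. (A, B) \<in> irreps n \<and> eigvals A \<in> sym_sigma \<sigma>} :: ((complex^'r^'r) \<times> (complex^'r^'r)) set set"
    have "topspace E = ?S"
      unfolding E_def X_sigma_def by (auto simp: X_star_def topspace_quot_topology)
    moreover have "?S \<inter> {c \<in> ?S. omega c \<in> U} = conj_class ` R"
    proof
      show "?S \<inter> {c \<in> ?S. omega c \<in> U} \<subseteq> conj_class ` R"
        by (auto simp: R_def omega_conj_class)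
      show "conj_class ` R \<subseteq> ?S \<inter> {c \<in> ?S. omega c \<in> U}"
        using U by (auto simp: R_def omega_conj_class base_set_def)
    qed
    ultimately show ?thesis
      by (simp add: E_def X_sigma_def subtopology_subtopology EU_def)
  qed
  have quot_R: "quotient_map (top_of_set R) EU conj_class"
    unfolding EU_def R_def by (rule conj_class_quotient)
  have R_diag: "(diag x, B) \<in> R \<longleftrightarrow> (diag x, B) \<in> irreps n \<and> unordered x \<in> U" for x B
    by (simp add: R_def eigvals_diag)
  have R_slice: "(diag (s u), B) \<in> R \<longleftrightarrow> B \<in> I" if u: "u \<in> U" for u B
  proof -
    have "unordered (s u) \<in> base_set n \<sigma>" using u U s_unordered by auto
    then have "\<forall>i j. s u $ i ^ n = s u $ j ^ n"
      using unordered_in_base_set_iff[OF s_torus[OF u]] by blast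
    then show ?thesis
      using u s_torus[OF u] s_unordered[OF u] irreducible_pair_diag_cong[OF pattern[OF u]]
      by (simp add: R_diag irreps_diag_iff I_def)
  qed
  have h_slice: "h (conj_class (diag (s u), B)) = (u, stab_class l B)" if u: "u \<in> U" for u B
  proof -
    have "omega (conj_class (diag (s u), B)) = u"
      using u by (simp add: omega_conj_class eigvals_diag s_unordered)
    then show ?thesis
      unfolding h_def using conj_class_slice[OF pattern[OF u]] by simp
  qed

  \<comment> \<open>All diagonalizations, those of pairs over \<open>U\<close>, and among these the ones whose diagonal is
    ordered by the section.\<close>
  define D where "D = (unitary_group :: (complex^'r^'r) set) \<times> (torus :: (complex^'r) set) \<times> (unitary_group :: (complex^'r^'r) set)"
  define D1 where "D1 = {w \<in> D. diag_conj w \<in> R}"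
  define D2 where "D2 = {w \<in> D1. s (unordered (fst (snd w))) = fst (snd w)}"
  have D1_mem: "(diag x, B) \<in> irreps n" "unordered x \<in> U" if "(g, x, B) \<in> D1" for g x B
  proof -
    have w: "g \<in> unitary_group" "pair_conj g (diag x, B) \<in> R"
      using that by (auto simp: D1_def D_def diag_conj_def)
    then show "unordered x \<in> U" by (simp add: R_def eigvals_conj eigvals_diag)
    have "pair_conj g (diag x, B) \<in> irreps n" using w(2) by (auto simp: R_def)
    then show "(diag x, B) \<in> irreps n"
      using irreps_conj[OF unitary_adj[OF w(1)], of "g ** diag x ** adj g" "g ** B ** adj g" n] w(1)
      by (simp add: conj_inverse)
  qed
  have cont_eig: "continuous_map (top_of_set D1) (subtopology sym_topology U) (\<lambda>w. unordered (fst (snd w)))"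
  proof (rule continuous_map_into_subtopology)
    have "continuous_map (top_of_set D1) (top_of_set torus) (\<lambda>w. fst (snd w))"
      by (auto simp: D1_def D_def intro!: continuous_intros)
    from continuous_map_compose[OF this continuous_map_unordered]
    show "continuous_map (top_of_set D1) sym_topology (\<lambda>w. unordered (fst (snd w)))"
      by (simp add: comp_def)
    show "(\<lambda>w. unordered (fst (snd w))) \<in> topspace (top_of_set D1) \<rightarrow> U"
      using D1_mem by auto
  qed
  have "continuous_map (top_of_set D1) (top_of_set torus) (\<lambda>w. s (unordered (fst (snd w))))"
    using continuous_map_compose[OF cont_eig s] by (simp add: comp_def)
  then have "continuous_on D1 (\<lambda>w. s (unordered (fst (snd w))) - fst (snd w))"
    by (auto intro!: continuous_intros)
  from continuous_closedin_preimage_constant[OF this, of 0]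
  have "closedin (top_of_set D1) D2" by (simp add: D2_def)
  moreover have "closed_map (top_of_set D1) (top_of_set R) diag_conj"
  proof -
    have "R \<subseteq> unitary_group \<times> unitary_group" by (auto simp: R_def irreps_def)
    then have "subtopology (top_of_set (unitary_group \<times> unitary_group)) R = top_of_set R"
      by (simp add: subtopology_subtopology Int_absorb1)
    moreover have "subtopology (top_of_set D) D1 = top_of_set D1"
      by (simp add: subtopology_subtopology D1_def Int_absorb1 subset_iff)
    ultimately show ?thesis
      using closed_map_restriction[OF closed_map_diag_conj, of R D1] by (simp add: D1_def D_def)
  qed
  ultimately have "closed_map (subtopology (top_of_set D1) D2) (top_of_set R) diag_conj"
    by (rule closed_map_from_subtopology[rotated])
  then have "closed_map (top_of_set D2) (top_of_set R) diag_conj"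
    by (simp add: subtopology_subtopology D2_def Int_absorb1 subset_iff)
  moreover have "diag_conj ` D2 = R"
  proof
    show "diag_conj ` D2 \<subseteq> R" by (auto simp: D2_def D1_def)
    show "R \<subseteq> diag_conj ` D2"
    proof clarify
      fix A B assume AB: "(A, B) \<in> R"
      then have "(A, B) \<in> irreps n" by (simp add: R_def)
      then obtain g x C where g: "g \<in> unitary_group" and C: "(diag x, C) \<in> irreps n"
        and ABg: "(A, B) = pair_conj g (diag x, C)"
        using irreps_diagonal_form by blast
      have u: "unordered x \<in> U" using AB ABg g by (simp add: R_def eigvals_conj eigvals_diag)
      then obtain p where p: "p permutes UNIV" "s (unordered x) = (\<chi> i. x $ p i)"
        using s_mem[OF u] by (auto simp: unordered_def)
      obtain P where P: "P \<in> unitary_group" "diag x = P ** diag (s (unordered x)) ** adj P"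
        using diag_permute_conj[OF p(1), of x] p(2) by metis
      have "C \<in> unitary_group" using C by (simp add: irreps_def)
      then have C': "adj P ** C ** P \<in> unitary_group"
        using unitary_conj[OF unitary_adj[OF P(1)]] by simp
      have "(A, B) = diag_conj (g ** P, s (unordered x), adj P ** C ** P)"
        using P(2) ABg conj_inverse[OF unitary_adj[OF P(1)], of C]
        by (simp add: diag_conj_def flip: conj_conj)
      moreover have "(g ** P, s (unordered x), adj P ** C ** P) \<in> D2"
        using calculation AB C' g P(1) u
        by (simp add: D2_def D1_def D_def unitary_mult s_torus s_unordered)
      ultimately show "(A, B) \<in> diag_conj ` D2" by blast
    qed
  qed
  ultimately have "quotient_map (top_of_set D2) (top_of_set R) diag_conj"
    by (intro continuous_closed_imp_quotient_map) (auto simp: continuous_on_diag_conj)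
  then have quot_D2: "quotient_map (top_of_set D2) EU (conj_class \<circ> diag_conj)"
    using quot_R by (rule quotient_map_compose)

  have D2_class: "conj_class (diag_conj (g, x, B)) = conj_class (diag (s (unordered x)), B)"
    and D2_mem: "B \<in> I" "unordered x \<in> U" if w: "(g, x, B) \<in> D2" for g x B
  proof -
    have g: "g \<in> unitary_group" "s (unordered x) = x" "(g, x, B) \<in> D1"
      using w by (auto simp: D2_def D1_def D_def)
    show "conj_class (diag_conj (g, x, B)) = conj_class (diag (s (unordered x)), B)"
    proof -
      have "conj_class (diag x, B) = conj_class (diag_conj (g, x, B))"
        unfolding conj_class_eq_iff diag_conj_def using g(1) by auto
      then show ?thesis using g(2) by simp
    qed
    show "unordered x \<in> U" using D1_mem[OF g(3)] by blast
    then show "B \<in> I" using R_slice[of "unordered x" B] D1_mem[OF g(3)] g(2) by (simp add: R_diag)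
  qed
  have cont_h: "continuous_map EU (prod_topology (subtopology sym_topology U) (F_fiber l)) h"
  proof (rule continuous_compose_quotient_map[OF quot_D2])
    have "continuous_map (top_of_set D2) (subtopology sym_topology U) (\<lambda>w. unordered (fst (snd w)))"
      using continuous_map_from_subtopology[OF cont_eig, of D2]
      by (simp add: subtopology_subtopology D2_def Int_absorb1 subset_iff)
    moreover have "continuous_map (top_of_set D2) (top_of_set I) (\<lambda>w. snd (snd w))"
      using D2_mem by (auto intro!: continuous_intros)
    then have "continuous_map (top_of_set D2) (F_fiber l) (stab_class l \<circ> (\<lambda>w. snd (snd w)))"
      by (rule continuous_map_compose)
        (use F_fiber_quotient(2)[of l] in \<open>simp add: I_def quotient_imp_continuous_map\<close>)
    ultimately have "continuous_map (top_of_set D2) (prod_topology (subtopology sym_topology U) (F_fiber l))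
        (\<lambda>w. (unordered (fst (snd w)), (stab_class l \<circ> (\<lambda>w. snd (snd w))) w))"
      by (rule continuous_map_pairedI)
    then show "continuous_map (top_of_set D2) (prod_topology (subtopology sym_topology U) (F_fiber l))
        (h \<circ> (conj_class \<circ> diag_conj))"
      by (rule continuous_map_eq) (use D2_class D2_mem h_slice in auto)
  qed

  define j where "j = (\<lambda>(u, B). conj_class (diag (s u), B))"
  have topspace_U: "topspace (subtopology sym_topology U) = U"
    using U_torus by (auto simp: topspace_sym)
  let ?UI = "prod_topology (subtopology sym_topology U) (top_of_set I)"
  have cont_j: "continuous_map ?UI EU j"
  proof -
    have "continuous_map ?UI euclidean (s \<circ> fst)"
      using continuous_map_into_fulltopology[OF s]
      by (rule continuous_map_compose[OF continuous_map_fst])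
    moreover have "continuous_map euclidean euclidean (diag :: complex^'r \<Rightarrow> _)"
      by (auto intro!: continuous_intros)
    ultimately have "continuous_map ?UI euclidean (diag \<circ> (s \<circ> fst))"
      by (rule continuous_map_compose)
    moreover have "continuous_map ?UI euclidean snd"
      using continuous_map_into_fulltopology[OF continuous_map_snd] by blast
    ultimately have "continuous_map ?UI (prod_topology euclidean euclidean) (\<lambda>w. ((diag \<circ> (s \<circ> fst)) w, snd w))"
      by (rule continuous_map_pairedI)
    then have "continuous_map ?UI (top_of_set R) (\<lambda>w. ((diag \<circ> (s \<circ> fst)) w, snd w))"
      using R_slice U_torus by (auto simp: continuous_map_in_subtopology topspace_sym)
    from continuous_map_compose[OF this quotient_imp_continuous_map[OF quot_R]] show ?thesis
      by (simp add: j_def comp_def case_prod_beta')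
  qed
  have "quotient_map ?UI (prod_topology (subtopology sym_topology U) (F_fiber l)) (\<lambda>(u, B). (u, stab_class l B))"
  proof (rule continuous_open_imp_quotient_map)
    have F: "quotient_map (top_of_set I) (F_fiber l) (stab_class l)"
      "open_map (top_of_set I) (F_fiber l) (stab_class l)"
      using F_fiber_quotient[of l] by (simp_all add: I_def)
    have "continuous_map ?UI (F_fiber l) (stab_class l \<circ> snd)"
      using continuous_map_snd quotient_imp_continuous_map[OF F(1)] by (rule continuous_map_compose)
    from continuous_map_pairedI[OF continuous_map_fst this]
    show "continuous_map ?UI (prod_topology (subtopology sym_topology U) (F_fiber l)) (\<lambda>(u, B). (u, stab_class l B))"
      by (simp add: case_prod_beta' comp_def)
    show "open_map ?UI (prod_topology (subtopology sym_topology U) (F_fiber l)) (\<lambda>(u, B). (u, stab_class l B))"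
      using open_map_prod[OF open_map_id F(2), of "subtopology sym_topology U"] by (simp add: id_def)
    show "(\<lambda>(u, B). (u, stab_class l B)) ` topspace ?UI = topspace (prod_topology (subtopology sym_topology U) (F_fiber l))"
    proof -
      have "(\<lambda>(u, B). (u, stab_class l B)) ` (U \<times> I) = U \<times> stab_class l ` I" by force
      then show ?thesis
        using quotient_imp_surjective_map[OF F(1)] by (simp add: topspace_U flip: topspace_subtopology)
    qed
  qed
  then have "quotient_map ?UI (prod_topology (subtopology sym_topology U) (F_fiber l)) (h \<circ> j)"
    by (rule quotient_map_eq) (auto simp: j_def h_slice)
  with cont_j cont_h have quot_h: "quotient_map EU (prod_topology (subtopology sym_topology U) (F_fiber l)) h"
    by (rule quotient_map_from_composition)
  have slice: "\<exists>u\<in>U. \<exists>B. c = conj_class (diag (s u), B)" if "c \<in> topspace EU" for c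
  proof -
    have "c \<in> (conj_class \<circ> diag_conj) ` D2"
      using quotient_imp_surjective_map[OF quot_D2] that by simp
    then obtain g x B where "(g, x, B) \<in> D2" "c = conj_class (diag_conj (g, x, B))"
      by auto
    then show ?thesis using D2_class D2_mem by blast
  qed
  have "inj_on h (topspace EU)"
  proof (rule inj_onI)
    fix c c' assume "c \<in> topspace EU" "c' \<in> topspace EU" and eq: "h c = h c'"
    then obtain u B u' B' where c: "u \<in> U" "c = conj_class (diag (s u), B)"
      and c': "u' \<in> U" "c' = conj_class (diag (s u'), B')"
      using slice by metis
    then have uu': "u' = u" and "stab_class l B = stab_class l B'"
      using eq by (simp_all add: h_slice)
    then obtain g where g: "g \<in> Stab l" "g ** B ** adj g = B'"
      by (auto simp: stab_class_eq_iff)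
    have "g \<in> Stab (s u)" using g(1) Stab_cong[OF pattern[OF c(1)]] by simp
    then have "g \<in> unitary_group" "pair_conj g (diag (s u), B) = (diag (s u'), B')"
      using g(2) uu' by (simp_all add: Stab_def)
    then show "c = c'" unfolding c(2) c'(2) conj_class_eq_iff by blast
  qed
  with quot_h have "homeomorphic_map EU (prod_topology (subtopology sym_topology U) (F_fiber l)) h"
    by (simp add: homeomorphic_map_def)
  then show ?thesis
    unfolding EU by (intro exI[of _ h]) (simp add: h_def)
qed

lemma continuous_map_omega:
  "continuous_map (X_sigma n \<sigma>) (subtopology sym_topology (base_set n \<sigma>))
     (omega :: _ \<Rightarrow> (complex^'r) set)"
proof -
  define R where "R = {(A :: complex^'r^'r, B). (A, B) \<in> irreps n \<and> eigvals A \<in> sym_sigma \<sigma>}"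
  have image: "{conj_class (A, B) | A B. (A, B) \<in> irreps n \<and> eigvals A \<in> sym_sigma \<sigma>} = conj_class ` R"
    by (auto simp: R_def)
  have "quotient_map (top_of_set R) (X_sigma n \<sigma>) conj_class"
    unfolding X_sigma_def image unfolding R_def by (rule conj_class_quotient)
  moreover have "continuous_map (top_of_set R) (subtopology sym_topology (base_set n \<sigma>)) (omega \<circ> conj_class)"
  proof (rule continuous_map_eq)
    have "R \<subseteq> unitary_group \<times> unitary_group" by (auto simp: R_def irreps_def)
    then have "continuous_map (top_of_set R) sym_topology (\<lambda>P. eigvals (fst P))"
      by (rule continuous_map_from_subtopology_mono[OF continuous_map_eigvals])
    then show "continuous_map (top_of_set R) (subtopology sym_topology (base_set n \<sigma>)) (\<lambda>P. eigvals (fst P))"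
      by (rule continuous_map_into_subtopology) (auto simp: R_def irreps_eigvals_in_base_set)
  qed (auto simp: omega_conj_class)
  ultimately show ?thesis by (rule continuous_compose_quotient_map)
qed

theorem proposition2p7:
  fixes n :: nat and \<sigma> :: "nat list" and l :: "complex^'r::{finite,wellorder}"
  assumes "n \<ge> 1"
    and "is_partition \<sigma> CARD('r)"
    and "l \<in> torus" and "block_ordered \<sigma> l"
  shows "zariski_locally_trivial
           (X_sigma n \<sigma>)
           (subtopology sym_topology (base_set n \<sigma>))
           (subtopology zariski_sym (base_set n \<sigma>))
           (F_fiber l)
           (omega :: _ \<Rightarrow> (complex^'r::{finite,wellorder}) set)"
  unfolding zariski_locally_trivial_def
proof (intro conjI ballI)
  show "continuous_map (X_sigma n \<sigma>) (subtopology sym_topology (base_set n \<sigma>))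
      (omega :: _ \<Rightarrow> (complex^'r::{finite,wellorder}) set)"
    by (rule continuous_map_omega)
  show "topspace (subtopology zariski_sym (base_set n \<sigma>)) =
      topspace (subtopology sym_topology (base_set n \<sigma> :: (complex^'r::{finite,wellorder}) set set))"
    by (simp add: zariski_sym_def sym_topology_def topspace_quot_topology topspace_zariski_torus)
  fix b :: "(complex^'r::{finite,wellorder}) set"
  assume "b \<in> topspace (subtopology sym_topology (base_set n \<sigma>))"
  then have b: "b \<in> base_set n \<sigma>" by simp
  have rearrange: "\<exists>p. p permutes UNIV \<and> (\<forall>i j. x $ p i = x $ p j \<longleftrightarrow> l $ i = l $ j)"
    if "has_type \<sigma> x" for x :: "complex^'r::{finite,wellorder}"
    using block_ordered_rearrangement[OF assms(2) that assms(4)] by metis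
  obtain U s where U: "openin (subtopology zariski_sym (base_set n \<sigma>)) U" "b \<in> U"
    and s: "continuous_map (subtopology sym_topology U) (top_of_set torus) s"
      "\<And>u. u \<in> U \<Longrightarrow> s u \<in> u" "\<And>u i j. u \<in> U \<Longrightarrow> s u $ i = s u $ j \<longleftrightarrow> l $ i = l $ j"
    using base_section[OF assms(1) rearrange b] by blast
  have sub: "U \<subseteq> base_set n \<sigma>" using openin_subset[OF U(1)] by simp
  then have "subtopology (subtopology sym_topology (base_set n \<sigma>)) U = subtopology sym_topology U"
    by (simp add: subtopology_subtopology Int_absorb1)
  with omega_trivial_over_section[OF sub s] U
  show "\<exists>U. openin (subtopology zariski_sym (base_set n \<sigma>)) U \<and> b \<in> U \<and>
      (\<exists>h. homeomorphic_map
            (subtopology (X_sigma n \<sigma>) {x \<in> topspace (X_sigma n \<sigma>). omega x \<in> U})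
            (prod_topology (subtopology (subtopology sym_topology (base_set n \<sigma>)) U) (F_fiber l)) h \<and>
          (\<forall>x\<in>topspace (X_sigma n \<sigma>). omega x \<in> U \<longrightarrow> fst (h x) = omega x))"
    by (intro exI[of _ U]) simp
qed

end
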